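(* Let $p\ge 1$, $\lambda>0$, $\varepsilon>0$, $y\in\mathbb{R}^m$, $x^+\in\operatorname{dom}f$, and let $$y^+=y+\lambda\nabla\phi^*\big(\nabla_yL_\lambda(x^+,y)\big),$$ where $L$, $L_\lambda$, $\psi$, $\phi$ and $f$ are as defined in the context. The following hold. (i) If $L(x^+,y^+)\le\inf_{x\in\mathbb{R}^n}L(x,y^+)+\varepsilon$, then $-\nabla_yL_\lambda(x^+,y)\in\partial_\varepsilon\psi(y^+)$. (ii) If $L_\lambda(x^+,y)\le\inf_{x\in\mathbb{R}^n}L_\lambda(x,y)+\varepsilon$, then $y^+$ is a $2^{p-1}\varepsilon$-proximal point, i.e., $$(\lambda\star\phi)\big(y^+-\operatorname{prox}_\psi^{\lambda\star\phi}(y)\big)\le2^{p-1}\varepsilon.$$ (iii) Assume that $\operatorname{dom}f$ is bounded, with diameter $D:=\sup_{x,x'\in\operatorname{dom}f}\|x-x'\|_2<\infty$. If $e\in\partial_xL_\lambda(x^+,y)$ satisfies $\|e\|_2\le\varepsilon/D$, then the hypotheses of both (i) and (ii) are valid, i.e., $L(x^+,y^+)\le\inf_{x}L(x,y^+)+\varepsilon$ and $L_\lambda(x^+,y)\le\inf_{x}L_\lambda(x,y)+\varepsilon$.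
   Context: Problem and Lagrangian. $f:\mathbb{R}^n\to\mathbb{R}\cup\{+\infty\}$ and $g:\mathbb{R}^m\to\mathbb{R}\cup\{+\infty\}$ are proper, lower semicontinuous and convex, and $\mathcal{A}:\mathbb{R}^n\to\mathbb{R}^m$ is a (possibly nonlinear) mapping. The primal problem is $\inf_{x}\{\varphi(x):=f(x)+g(\mathcal{A}(x))\}$, which is convex, and its Lagrangian $$L(x,y)=f(x)+\langle\mathcal{A}(x),y\rangle-g^*(y)$$ is convex in $x$ and concave in $y$ ($g^*$ is the convex conjugate; $L(x,y)=+\infty$ if $x\notin\operatorname{dom}f$, and $L(x,y)=-\infty$ if $x\in\operatorname{dom}f$, $y\notin\operatorname{dom}g^*$). The Lagrange dual function is $\varrho(y)=\inf_xL(x,y)$ and $\psi:=-\varrho$. Standing assumption: strong duality $\sup_y\varrho(y)=\inf_x\varphi(x)$ holds and primal and dual solutions exist. Prox-function. $\|\cdot\|$ denotes $\|\cdot\|_r$ on $\mathbb{R}^m$, where either $r=2$ or $r=p+1$; $\phi:=\frac1{p+1}\|\cdot\|^{p+1}$; its convex conjugate is $\phi^*=\frac1{q+1}\|\cdot\|_*^{q+1}$ with $\frac1{p+1}+\frac1{q+1}=1$ and $\|\cdot\|_*$ the dual norm. The epi-scaling is $(\lambda\star\phi)(x)=\lambda\phi(\lambda^{-1}x)=\lambda^{-p}\frac1{p+1}\|x\|^{p+1}$. Augmented Lagrangian: $L_\lambda(x,y):=\sup_{\eta\in\mathbb{R}^m}\{L(x,\eta)-(\lambda\star\phi)(y-\eta)\}$.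 For $x\in\operatorname{dom}f$ it is differentiable in $y$, with $\nabla_yL_\lambda(x,y)=-\nabla\phi(\lambda^{-1}(y-\bar\eta))$, where $\bar\eta$ is the unique maximizer in the definition of $L_\lambda(x,y)$. $\partial_xL_\lambda$ is the convex subdifferential with respect to $x$. Proximal mapping: $\operatorname{prox}_\psi^{\lambda\star\phi}(y)=\operatorname*{argmin}_{\eta}\{\psi(\eta)+(\lambda\star\phi)(y-\eta)\}$ (unique minimizer). The $\varepsilon$-subdifferential $\partial_\varepsilon\psi(\bar y)$ at $\bar y\in\operatorname{dom}\psi$ is the set of $v$ with $\psi(y)\ge\psi(\bar y)+\langle v,y-\bar y\rangle-\varepsilon$ for all $y\in\operatorname{dom}\psi$. *)

theory Defs
  imports "HOL-Analysis.Analysis"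
begin

section \<open>Convex analysis of extended-real-valued functions\<close>

definition edom :: "('a \<Rightarrow> ereal) \<Rightarrow> 'a set" where
  "edom h = {x. h x < \<infinity>}"

definition proper_fun :: "('a \<Rightarrow> ereal) \<Rightarrow> bool" where
  "proper_fun h \<longleftrightarrow> edom h \<noteq> {} \<and> (\<forall>x. h x \<noteq> -\<infinity>)"

definition lsc_fun :: "('a::topological_space \<Rightarrow> ereal) \<Rightarrow> bool" where
  "lsc_fun h \<longleftrightarrow> (\<forall>x. h x \<le> Liminf (at x) h)"

text \<open>Convexity is convexity of the epigraph. This also makes sense for functions taking both
  infinite values, such as the Lagrangian below, without any convention for
  \<open>\<infinity> - \<infinity>\<close>.\<close>

definition convex_fun :: "('a::real_vector \<Rightarrow> ereal) \<Rightarrow> bool" where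
  "convex_fun h \<longleftrightarrow> convex {(x, t::real). h x \<le> ereal t}"

definition convex_conjugate :: "('a::real_inner \<Rightarrow> ereal) \<Rightarrow> 'a \<Rightarrow> ereal" where
  "convex_conjugate h y = (SUP x. ereal (x \<bullet> y) - h x)"

definition subdifferential :: "('a::real_inner \<Rightarrow> ereal) \<Rightarrow> 'a \<Rightarrow> 'a set" where
  "subdifferential h a =
     {v. a \<in> edom h \<and> (\<forall>x. h x \<ge> h a + ereal (v \<bullet> (x - a)))}"

definition eps_subdifferential :: "real \<Rightarrow> ('a::real_inner \<Rightarrow> ereal) \<Rightarrow> 'a \<Rightarrow> 'a set" where
  "eps_subdifferential \<epsilon> h a =
     {v. a \<in> edom h \<and> (\<forall>x \<in> edom h. h x \<ge> h a + ereal (v \<bullet> (x - a)) - ereal \<epsilon>)}"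

text \<open>The gradient is a definite description: it is meaningful only at points of
  differentiability, where it is unique.\<close>

definition gradient :: "('a::real_inner \<Rightarrow> real) \<Rightarrow> 'a \<Rightarrow> 'a" where
  "gradient h x = (THE D. GDERIV h x :> D)"

section \<open>Prox-function, epi-scaling and proximal mapping\<close>

definition lnorm :: "real \<Rightarrow> real ^ 'm \<Rightarrow> real" where
  "lnorm r x = (\<Sum>i\<in>UNIV. \<bar>x $ i\<bar> powr r) powr (1 / r)"

definition prox_fun :: "real \<Rightarrow> real \<Rightarrow> real ^ 'm \<Rightarrow> real" where
  "prox_fun r p x = 1 / (p + 1) * lnorm r x powr (p + 1)"

text \<open>The conjugate of the prox-function is finite everywhere, so reading it as a real-valued
  function loses nothing.\<close>

definition prox_fun_conj :: "real \<Rightarrow> real \<Rightarrow> real ^ 'm \<Rightarrow> real" where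
  "prox_fun_conj r p v = real_of_ereal (convex_conjugate (\<lambda>x. ereal (prox_fun r p x)) v)"

definition epi_scale :: "real \<Rightarrow> ('a::real_vector \<Rightarrow> real) \<Rightarrow> 'a \<Rightarrow> real" where
  "epi_scale lam h x = lam * h (inverse lam *\<^sub>R x)"

text \<open>As with the gradient, the definite description relies on the minimizer being unique.\<close>

definition prox_map :: "('a::real_vector \<Rightarrow> ereal) \<Rightarrow> ('a \<Rightarrow> real) \<Rightarrow> 'a \<Rightarrow> 'a" where
  "prox_map h k y = (THE \<eta>. is_arg_min (\<lambda>\<zeta>. h \<zeta> + ereal (k (y - \<zeta>))) (\<lambda>_. True) \<eta>)"

section \<open>Lagrangian and augmented Lagrangian\<close>

definition primal_fun ::
    "('n \<Rightarrow> ereal) \<Rightarrow> ('m \<Rightarrow> ereal) \<Rightarrow> ('n \<Rightarrow> 'm) \<Rightarrow> 'n \<Rightarrow> ereal" where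
  "primal_fun f g A x = f x + g (A x)"

definition lagrangian ::
    "('n \<Rightarrow> ereal) \<Rightarrow> ('m::real_inner \<Rightarrow> ereal) \<Rightarrow> ('n \<Rightarrow> 'm) \<Rightarrow> 'n \<Rightarrow> 'm \<Rightarrow> ereal" where
  "lagrangian f g A x y =
     (if x \<notin> edom f then \<infinity>
      else if y \<notin> edom (convex_conjugate g) then -\<infinity>
      else f x + ereal (A x \<bullet> y) - convex_conjugate g y)"

definition dual_fun :: "('n \<Rightarrow> 'm \<Rightarrow> ereal) \<Rightarrow> 'm \<Rightarrow> ereal" where
  "dual_fun L y = (INF x. L x y)"

definition aug_lagrangian ::
    "('n \<Rightarrow> 'm::real_vector \<Rightarrow> ereal) \<Rightarrow> ('m \<Rightarrow> real) \<Rightarrow> 'n \<Rightarrow> 'm \<Rightarrow> ereal" where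
  "aug_lagrangian L k x y = (SUP \<eta>. L x \<eta> - ereal (k (y - \<eta>)))"

text \<open>The augmented Lagrangian is finite when its first argument lies in the domain of
  \<open>f\<close>, and only there is its gradient in the second argument used.\<close>

definition grad_y :: "('n \<Rightarrow> 'm::real_inner \<Rightarrow> ereal) \<Rightarrow> 'n \<Rightarrow> 'm \<Rightarrow> 'm" where
  "grad_y K x y = gradient (\<lambda>z. real_of_ereal (K x z)) y"

end

theory Submission
  imports Defs
begin

text \<open>
Everything rests on one inequality, the uniform convexity of the prox-function with the
constant \<open>c = 2 powr (1 - p)\<close>:
\<open>\<phi> w + \<nabla>\<phi> w \<bullet> (z - w) + c * \<phi> (z - w) \<le> \<phi> z\<close>.
On the real line it is integrated from a strong monotonicity estimate for signed powers
(\<open>abs_powr_uniformly_convex\<close>). For \<open>r = p + 1\<close> it is summed over the coordinates. For \<open>r = 2\<close> the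
defect of the inequality, with the norms of \<open>z\<close> and \<open>w\<close> held fixed, is a concave function of the
squared distance of \<open>z\<close> and \<open>w\<close>, so only the two collinear configurations matter
(\<open>norm_powr_uniformly_convex\<close>). The locale \<open>prox_kernel\<close> records this inequality together with
continuity of the gradient and growth; it is inherited by the epi-scaling.

Let \<open>\<eta>\<close> be the maximizer that defines the augmented Lagrangian at \<open>(x\<^sup>+, y)\<close>. Fenchel duality for
\<open>\<phi>\<close> (\<open>gradient_conjugate\<close>) and the derivative of the Moreau envelope
(\<open>grad_y_aug_lagrangian\<close>) show that \<open>y\<^sup>+ = \<eta>\<close>. The optimality condition at \<open>\<eta>\<close>,
combined with \<open>\<psi> \<ge> - L x\<^sup>+\<close>, gives (i).

For (ii), uniform convexity makes \<open>- L x\<^sup>+ \<zeta> + k (y - \<zeta>)\<close>, where \<open>k\<close> is the scaled prox-function,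
grow by \<open>c * k (\<zeta> - \<eta>)\<close> away from its minimizer \<open>\<eta>\<close>. Evaluated at the proximal point, this
growth is bounded by \<open>\<epsilon>\<close> as soon as
\<open>inf_x sup_\<zeta> (L x \<zeta> - k (y - \<zeta>)) \<le> sup_\<zeta> inf_x (L x \<zeta> - k (y - \<zeta>))\<close>. This
minimax inequality (\<open>minimax\<close>) uses convexity in \<open>x\<close> and compactness in \<open>\<zeta>\<close>: the upper level sets in \<open>\<zeta>\<close> are compact and
convex, by Helly's theorem and compactness it suffices to intersect \<open>m + 1\<close> of them, and for finitely many
a separating hyperplane provides weights whose convex combination of the points \<open>x\<close> would contradict
the value of the infimum.

For (iii), an affine minorant with slope of norm at most \<open>\<epsilon> / D\<close> varies by at most \<open>\<epsilon>\<close> over the domain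
of \<open>f\<close>. This settles the augmented Lagrangian at once, and it settles \<open>L\<close> because every subgradient of the
augmented Lagrangian at \<open>x\<^sup>+\<close> is a subgradient of \<open>L\<close> at \<open>(x\<^sup>+, \<eta>)\<close>
(\<open>subgradient_transfer\<close>, a Danskin-type argument along segments).
\<close>

section \<open>Uniform convexity of powers\<close>

lemma powr_convex_combination:
  fixes a b t p :: real
  assumes p: "1 \<le> p" and a: "0 \<le> a" and b: "0 \<le> b" and t: "0 \<le> t" "t \<le> 1"
  shows "((1 - t) * a + t * b) powr p \<le> (1 - t) * a powr p + t * b powr p"
proof -
  have shrink: "(s * c) powr p \<le> s * c powr p" if "0 \<le> s" "s \<le> 1" "0 \<le> c" for s c :: real
  proof (cases "s = 0")
    case False
    have "s powr p \<le> s powr 1"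
      using that p by (intro powr_mono') auto
    then show ?thesis
      using that by (simp add: powr_mult mult_right_mono)
  qed simp
  consider "a = 0" | "b = 0" | "0 < a" "0 < b"
    using a b by fastforce
  then show ?thesis
  proof cases
    case 1
    then show ?thesis using shrink[of t b] t b by simp
  next
    case 2
    then show ?thesis using shrink[of "1 - t" a] t a by simp
  next
    case 3
    then show ?thesis
      using convex_onD[OF powr_convex[OF p] t, of a b] by simp
  qed
qed

lemma powr_superadditive:
  fixes a b p :: real
  assumes p: "1 \<le> p" and a: "0 \<le> a" and b: "0 \<le> b"
  shows "a powr p + b powr p \<le> (a + b) powr p"
proof -
  have le: "x powr p \<le> x * (a + b) powr (p - 1)" if "0 \<le> x" "x \<le> a + b" for x
  proof (cases "x = 0")
    case False
    then have "x powr p = x * x powr (p - 1)"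
      using that by (simp add: powr_mult_base)
    also have "\<dots> \<le> x * (a + b) powr (p - 1)"
      using that p by (intro mult_left_mono powr_mono2) auto
    finally show ?thesis .
  qed simp
  have "a powr p + b powr p \<le> (a + b) * (a + b) powr (p - 1)"
    using le[of a] le[of b] a b by (simp add: distrib_right)
  also have "\<dots> = (a + b) powr p"
    using a b by (simp add: powr_mult_base)
  finally show ?thesis .
qed

text \<open>Midpoint convexity of the power function, solved for the sum of the powers.\<close>

lemma powr_sum_ge:
  fixes a b p :: real
  assumes p: "1 \<le> p" and a: "0 \<le> a" and b: "0 \<le> b"
  shows "2 powr (1 - p) * (a + b) powr p \<le> a powr p + b powr p"
proof -
  have "((a + b) / 2) powr p \<le> (a powr p + b powr p) / 2"
    using powr_convex_combination[OF p a b, of "1/2"] by (simp add: field_simps)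
  moreover have "((a + b) / 2) powr p = (a + b) powr p * 2 powr (1 - p) / 2"
    using a b by (simp add: powr_divide powr_diff)
  ultimately show ?thesis by (simp add: mult.commute)
qed

text \<open>The derivative of \<open>\<bar>x\<bar> powr (p + 1) / (p + 1)\<close>.\<close>

definition signed_powr :: "real \<Rightarrow> real \<Rightarrow> real" where
  "signed_powr p x = sgn x * \<bar>x\<bar> powr p"

lemma signed_powr_minus [simp]: "signed_powr p (- x) = - signed_powr p x"
  by (simp add: signed_powr_def sgn_minus)

lemma signed_powr_nonneg: "0 \<le> x \<Longrightarrow> signed_powr p x = x powr p"
  by (cases "x = 0") (auto simp: signed_powr_def)

lemma signed_powr_nonpos: "x \<le> 0 \<Longrightarrow> signed_powr p x = - ((- x) powr p)"
  by (cases "x = 0") (auto simp: signed_powr_def)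

text \<open>For arguments of the same sign superadditivity gives even the constant \<open>1\<close>; for opposite signs
the estimate is power-mean convexity, and it is there that \<open>2 powr (1 - p)\<close> is attained, at
\<open>b = - a\<close>.\<close>

lemma signed_powr_strong_mono:
  fixes a b p :: real
  assumes p: "1 \<le> p" and ab: "b \<le> a"
  shows "2 powr (1 - p) * (a - b) powr p \<le> signed_powr p a - signed_powr p b"
proof -
  have same_sign: "2 powr (1 - p) * (a - b) powr p \<le> a powr p - b powr p"
    if "0 \<le> b" "b \<le> a" for a b :: real
  proof -
    have "2 powr (1 - p) * (a - b) powr p \<le> (a - b) powr p"
      using p powr_mono[of "1 - p" 0 2] by (intro mult_left_le_one_le) auto
    then show ?thesis
      using powr_superadditive[OF p, of "a - b" b] that by simp
  qed
  consider "0 \<le> b" | "b \<le> 0" "0 \<le> a" | "a \<le> 0"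
    using ab by linarith
  then show ?thesis
  proof cases
    case 1
    then show ?thesis using same_sign[of b a] ab by (simp add: signed_powr_nonneg)
  next
    case 2
    then show ?thesis
      using powr_sum_ge[OF p, of a "- b"] by (simp add: signed_powr_nonneg signed_powr_nonpos)
  next
    case 3
    then show ?thesis
      using same_sign[of "- a" "- b"] ab by (simp add: signed_powr_nonpos)
  qed
qed

lemma has_real_derivative_abs_powr:
  fixes x p :: real
  assumes p: "1 \<le> p"
  shows "((\<lambda>x. \<bar>x\<bar> powr (p + 1) / (p + 1)) has_real_derivative signed_powr p x) (at x)"
proof -
  consider "0 < x" | "x < 0" | "x = 0" by linarith
  then show ?thesis
  proof cases
    case 1
    have "((\<lambda>x. x powr (p + 1) / (p + 1)) has_real_derivative signed_powr p x) (at x)"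
      using 1 p by (auto intro!: derivative_eq_intros simp: signed_powr_nonneg)
    then show ?thesis
      by (rule has_field_derivative_transform_within_open[of _ _ _ "{0<..}"]) (use 1 in auto)
  next
    case 2
    have "((\<lambda>x. (- x) powr (p + 1) / (p + 1)) has_real_derivative signed_powr p x) (at x)"
      using 2 p by (auto intro!: derivative_eq_intros simp: signed_powr_nonpos)
    then show ?thesis
      by (rule has_field_derivative_transform_within_open[of _ _ _ "{..<0}"]) (use 2 in auto)
  next
    case 3
    \<comment> \<open>At the kink the difference quotient is dominated by \<open>\<bar>h\<bar> powr p / (p + 1)\<close>.\<close>
    have lim: "((\<lambda>h::real. \<bar>h\<bar> powr p / (p + 1)) \<longlongrightarrow> 0) (at 0)"
      using p by (auto intro!: tendsto_eq_intros)
    have bound: "norm (\<bar>h\<bar> powr (p + 1) / (p + 1) / h) \<le> \<bar>h\<bar> powr p / (p + 1)" for h :: real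
    proof (cases "h = 0")
      case False
      then have "\<bar>h\<bar> powr (p + 1) = \<bar>h\<bar> * \<bar>h\<bar> powr p"
        by (simp add: powr_mult_base add.commute)
      then show ?thesis using p False by (simp add: abs_mult)
    qed (use p in simp)
    have "((\<lambda>h::real. \<bar>h\<bar> powr (p + 1) / (p + 1) / h) \<longlongrightarrow> 0) (at 0)"
      by (rule Lim_null_comparison[OF always_eventually[OF allI[OF bound]] lim])
    then show ?thesis
      unfolding 3 DERIV_def signed_powr_def by simp
  qed
qed

text \<open>The right-hand side minus the left-hand side vanishes at \<open>z = w\<close>, and by strong monotonicity of the derivative
it decreases before \<open>w\<close> and increases after \<open>w\<close>.\<close>

lemma abs_powr_uniformly_convex:
  fixes z w p :: real
  assumes p: "1 \<le> p"
  shows "\<bar>w\<bar> powr (p + 1) / (p + 1) + signed_powr p w * (z - w)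
           + 2 powr (1 - p) * (\<bar>z - w\<bar> powr (p + 1) / (p + 1))
         \<le> \<bar>z\<bar> powr (p + 1) / (p + 1)"
proof -
  define G where "G = (\<lambda>z. \<bar>z\<bar> powr (p + 1) / (p + 1) - signed_powr p w * (z - w)
           - 2 powr (1 - p) * (\<bar>z - w\<bar> powr (p + 1) / (p + 1)))"
  define G' where "G' = (\<lambda>z. signed_powr p z - signed_powr p w
           - 2 powr (1 - p) * signed_powr p (z - w))"
  have "((\<lambda>z. \<bar>z - w\<bar> powr (p + 1) / (p + 1)) has_real_derivative signed_powr p (z - w)) (at z)" for z
    using DERIV_shift[of "\<lambda>z. \<bar>z\<bar> powr (p + 1) / (p + 1)" "signed_powr p (z - w)" z "- w"]
      has_real_derivative_abs_powr[OF p, of "z - w"] by simp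
  then have G: "(G has_real_derivative
      signed_powr p z - signed_powr p w * (1 - 0) - 2 powr (1 - p) * signed_powr p (z - w)) (at z)" for z
    unfolding G_def
    by (intro DERIV_diff DERIV_cmult has_real_derivative_abs_powr[OF p] DERIV_ident DERIV_const)
  then have G: "(G has_real_derivative G' z) (at z)" for z
    by (simp add: G'_def)
  have up: "0 \<le> G' z" if "w \<le> z" for z
    using signed_powr_strong_mono[OF p that] that by (simp add: G'_def signed_powr_nonneg)
  have dn: "G' z \<le> 0" if "z \<le> w" for z
    using signed_powr_strong_mono[OF p that] that
    by (simp add: G'_def signed_powr_nonpos)
  have "G w \<le> G z"
  proof (cases "w \<le> z")
    case True
    then show ?thesis
      by (intro DERIV_nonneg_imp_nondecreasing[of w z G]) (use G up in auto)
  next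
    case False
    then show ?thesis
      by (intro DERIV_nonpos_imp_nonincreasing[of z w G]) (use G dn in auto)
  qed
  then show ?thesis
    using p by (simp add: G_def)
qed

text \<open>With \<open>a = norm w\<close> and \<open>b = norm z\<close> held fixed, the left-hand side depends only on the squared distance
\<open>u\<close> between \<open>z\<close> and \<open>w\<close>, and is convex in \<open>u\<close>: the inner product is affine in \<open>u\<close>, and the
last term is \<open>u powr ((p + 1) / 2)\<close> up to a factor. By Cauchy-Schwarz \<open>u\<close> lies between
\<open>(b - a)\<^sup>2\<close> and \<open>(a + b)\<^sup>2\<close>, and at these two ends the vectors are collinear, so that
the scalar inequality applies to \<open>b\<close> and to \<open>- b\<close>.\<close>

lemma norm_powr_uniformly_convex:
  fixes z w :: "'a::real_inner"
  assumes p: "1 \<le> p"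
  shows "norm w powr (p + 1) / (p + 1) + (norm w powr p *\<^sub>R sgn w) \<bullet> (z - w)
           + 2 powr (1 - p) * (norm (z - w) powr (p + 1) / (p + 1))
         \<le> norm z powr (p + 1) / (p + 1)"
proof (cases "w = 0")
  case True
  have "2 powr (1 - p) \<le> (1::real)"
    using p powr_mono[of "1 - p" 0 2] by simp
  then have "2 powr (1 - p) * (norm z powr (p + 1) / (p + 1)) \<le> norm z powr (p + 1) / (p + 1)"
    using p by (intro mult_left_le_one_le) auto
  then show ?thesis
    using True by simp
next
  case False
  define a where "a = norm w"
  define b where "b = norm z"
  define u where "u = (norm (z - w))\<^sup>2"
  define u0 where "u0 = (b - a)\<^sup>2"
  define u1 where "u1 = (a + b)\<^sup>2"
  define s where "s = (p + 1) / 2"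
  define \<gamma> where "\<gamma> = 2 powr (1 - p)"
  have ab: "0 < a" "0 \<le> b" and s: "1 \<le> s" and \<gamma>: "0 \<le> \<gamma>"
    using False p by (auto simp: a_def b_def s_def \<gamma>_def)
  have sq_powr: "(t\<^sup>2) powr s = \<bar>t\<bar> powr (p + 1)" for t :: real
  proof (cases "t = 0")
    case False
    then have "t\<^sup>2 = \<bar>t\<bar> powr 2" by simp
    moreover have "2 * s = p + 1" by (simp add: s_def)
    ultimately show ?thesis by (simp only: powr_powr)
  qed simp
  have wz: "w \<bullet> z = (a\<^sup>2 + b\<^sup>2 - u) / 2"
    by (simp add: a_def b_def u_def power2_norm_eq_inner inner_diff inner_commute)
  have "\<bar>w \<bullet> z\<bar> \<le> a * b"
    unfolding a_def b_def by (rule Cauchy_Schwarz_ineq2)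
  then have u: "u0 \<le> u" "u \<le> u1"
    unfolding u0_def u1_def power2_sum power2_diff wz abs_le_iff by (auto simp: field_simps)
  define \<theta> where "\<theta> = (u - u0) / (u1 - u0)"
  have \<theta>: "0 \<le> \<theta>" "\<theta> \<le> 1"
    using u unfolding \<theta>_def by (auto simp: divide_le_eq_1)
  have u_eq: "u = (1 - \<theta>) * u0 + \<theta> * u1"
  proof (cases "u0 = u1")
    case False
    then have "\<theta> * (u1 - u0) = u - u0" by (simp add: \<theta>_def)
    then show ?thesis by (simp add: algebra_simps)
  qed (use u in \<open>simp add: algebra_simps\<close>)
  define e where "e = a powr p / a"
  have ea: "signed_powr p a = e * a"
    using ab by (simp add: e_def signed_powr_nonneg)
  have "e * ((b\<^sup>2 - a\<^sup>2 - u0) / 2) = signed_powr p a * (b - a)"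
    by (simp add: ea u0_def power2_eq_square field_simps)
  then have "a powr (p + 1) / (p + 1) + e * ((b\<^sup>2 - a\<^sup>2 - u0) / 2) + \<gamma> * (u0 powr s / (p + 1))
      \<le> b powr (p + 1) / (p + 1)"
    using abs_powr_uniformly_convex[OF p, of a b] ab
    by (simp add: u0_def sq_powr \<gamma>_def)
  moreover have "e * ((b\<^sup>2 - a\<^sup>2 - u1) / 2) = signed_powr p a * (- b - a)"
    by (simp add: ea u1_def power2_eq_square field_simps)
  then have "a powr (p + 1) / (p + 1) + e * ((b\<^sup>2 - a\<^sup>2 - u1) / 2) + \<gamma> * (u1 powr s / (p + 1))
      \<le> b powr (p + 1) / (p + 1)"
    using abs_powr_uniformly_convex[OF p, of a "- b"] ab
    by (simp add: u1_def sq_powr \<gamma>_def add.commute)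
  moreover have "e * ((b\<^sup>2 - a\<^sup>2 - u) / 2)
      = (1 - \<theta>) * (e * ((b\<^sup>2 - a\<^sup>2 - u0) / 2)) + \<theta> * (e * ((b\<^sup>2 - a\<^sup>2 - u1) / 2))"
    unfolding u_eq by (simp add: field_simps)
  moreover have "\<gamma> * (u powr s / (p + 1))
      \<le> (1 - \<theta>) * (\<gamma> * (u0 powr s / (p + 1))) + \<theta> * (\<gamma> * (u1 powr s / (p + 1)))"
  proof -
    have "\<gamma> * (u powr s / (p + 1)) \<le> \<gamma> * (((1 - \<theta>) * u0 powr s + \<theta> * u1 powr s) / (p + 1))"
      using p \<gamma> \<theta> unfolding u_eq
      by (intro mult_left_mono divide_right_mono powr_convex_combination s) (auto simp: u0_def u1_def)
    then show ?thesis
      by (simp add: add_divide_distrib distrib_left mult_ac)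
  qed
  moreover have "X + E + G \<le> B"
    if "X + E0 + G0 \<le> B" "X + E1 + G1 \<le> B"
      "E = (1 - \<theta>) * E0 + \<theta> * E1" "G \<le> (1 - \<theta>) * G0 + \<theta> * G1" for X E G B E0 G0 E1 G1 :: real
    using convex_bound_le[OF that(1,2), of "1 - \<theta>" \<theta>] that(3,4) \<theta> by (simp add: algebra_simps)
  ultimately have "a powr (p + 1) / (p + 1) + e * ((b\<^sup>2 - a\<^sup>2 - u) / 2) + \<gamma> * (u powr s / (p + 1))
      \<le> b powr (p + 1) / (p + 1)"
    by blast
  moreover have "u powr s = norm (z - w) powr (p + 1)"
    unfolding u_def sq_powr by simp
  moreover have "(norm w powr p *\<^sub>R sgn w) \<bullet> (z - w) = e * ((b\<^sup>2 - a\<^sup>2 - u) / 2)"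
  proof -
    have "norm w powr p *\<^sub>R sgn w = e *\<^sub>R w"
      by (simp add: e_def a_def sgn_div_norm divide_inverse)
    moreover have "w \<bullet> w = a\<^sup>2"
      by (simp add: a_def power2_norm_eq_inner)
    ultimately have "(norm w powr p *\<^sub>R sgn w) \<bullet> (z - w) = e * ((a\<^sup>2 + b\<^sup>2 - u) / 2 - a\<^sup>2)"
      by (simp add: inner_diff_right wz algebra_simps)
    also have "(a\<^sup>2 + b\<^sup>2 - u) / 2 - a\<^sup>2 = (b\<^sup>2 - a\<^sup>2 - u) / 2"
      by (simp add: field_simps)
    finally show ?thesis .
  qed
  ultimately show ?thesis
    by (simp add: a_def b_def \<gamma>_def)
qed

text \<open>The case of the real line is the continuity of \<open>signed_powr\<close>.\<close>

lemma continuous_on_norm_powr_sgn: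
  assumes p: "0 < p"
  shows "continuous_on UNIV (\<lambda>x::'a::real_inner. norm x powr p *\<^sub>R sgn x)"
proof -
  have "isCont (\<lambda>x::'a. norm x powr p *\<^sub>R sgn x) x" for x
  proof (cases "x = 0")
    case True
    have lim: "((\<lambda>x::'a. norm x powr p) \<longlongrightarrow> 0) (at 0)"
      using p by (auto intro!: tendsto_eq_intros)
    have "((\<lambda>x::'a. norm x powr p *\<^sub>R sgn x) \<longlongrightarrow> 0) (at 0)"
      by (rule Lim_null_comparison[OF _ lim]) (simp add: norm_sgn)
    then show ?thesis using True by (simp add: isCont_def)
  next
    case False
    then show ?thesis
      unfolding sgn_div_norm by (intro continuous_intros) auto
  qed
  then show ?thesis by (simp add: continuous_on_eq_continuous_at)
qed

section \<open>Uniformly convex prox-functions\<close>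

text \<open>
The constant \<open>c\<close> is the one of uniform convexity. The growth condition gives coercivity and, in the
conjugate, differentiability. That \<open>d\<phi>\<close> is the gradient of \<open>\<phi>\<close> follows from its being a
continuous selection of subgradients (\<open>has_gradient\<close> below).
\<close>

locale prox_kernel =
  fixes \<phi> :: "'b::euclidean_space \<Rightarrow> real" and d\<phi> :: "'b \<Rightarrow> 'b" and p c :: real
  assumes p: "1 \<le> p" and c: "0 < c"
    and uniformly_convex: "\<phi> w + d\<phi> w \<bullet> (z - w) + c * \<phi> (z - w) \<le> \<phi> z"
    and grad_continuous: "continuous_on UNIV d\<phi>"
    and growth: "\<exists>\<kappa>>0. \<forall>z. \<kappa> * norm z powr (p + 1) \<le> \<phi> z"
    and even: "\<phi> (- z) = \<phi> z"
    and odd: "d\<phi> (- z) = - d\<phi> z"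

lemma lnorm_two: "lnorm 2 x = norm x"
  by (simp add: lnorm_def norm_vec_def L2_set_def powr_half_sqrt sum_nonneg)

lemma abs_component_le_lnorm:
  assumes "0 < r"
  shows "\<bar>x $ i\<bar> \<le> lnorm r x"
proof -
  have "\<bar>x $ i\<bar> powr r \<le> (\<Sum>j\<in>UNIV. \<bar>x $ j\<bar> powr r)"
    by (rule member_le_sum) auto
  then have "(\<bar>x $ i\<bar> powr r) powr (1 / r) \<le> lnorm r x"
    unfolding lnorm_def using assms by (intro powr_mono2) auto
  then show ?thesis using assms by (simp add: powr_powr)
qed

text \<open>A crude comparison of norms; only the existence of a constant matters for the growth condition.\<close>

lemma norm_le_lnorm:
  fixes x :: "real ^ 'm"
  assumes "0 < r"
  shows "norm x \<le> real CARD('m) * lnorm r x"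
proof -
  have "norm x \<le> (\<Sum>i\<in>UNIV. \<bar>x $ i\<bar>)" by (rule norm_le_l1_cart)
  also have "\<dots> \<le> (\<Sum>i\<in>(UNIV :: 'm set). lnorm r x)"
    by (intro sum_mono abs_component_le_lnorm assms)
  finally show ?thesis by simp
qed

lemma prox_fun_growth:
  fixes p r :: real
  assumes p: "1 \<le> p" and r: "0 < r"
  shows "\<exists>\<kappa>>0. \<forall>z::real ^ 'm. \<kappa> * norm z powr (p + 1) \<le> prox_fun r p z"
proof (intro exI conjI allI)
  let ?m = "real CARD('m)"
  show "0 < 1 / (p + 1) * (1 / ?m powr (p + 1))"
    using p by simp
  fix z :: "real ^ 'm"
  have "norm z powr (p + 1) \<le> (?m * lnorm r z) powr (p + 1)"
    using p by (intro powr_mono2 norm_le_lnorm[OF r]) auto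
  also have "\<dots> = ?m powr (p + 1) * lnorm r z powr (p + 1)"
    by (rule powr_mult)
  finally have "norm z powr (p + 1) / ?m powr (p + 1) \<le> lnorm r z powr (p + 1)"
    by (simp add: divide_le_eq mult.commute)
  then have "1 / (p + 1) * (norm z powr (p + 1) / ?m powr (p + 1)) \<le> prox_fun r p z"
    unfolding prox_fun_def using p by (intro mult_left_mono) auto
  then show "1 / (p + 1) * (1 / ?m powr (p + 1)) * norm z powr (p + 1) \<le> prox_fun r p z"
    by simp
qed

lemma prox_fun_euclidean: "prox_fun 2 p x = norm x powr (p + 1) / (p + 1)"
  by (simp add: prox_fun_def lnorm_two)

lemma prox_fun_separable:
  assumes "1 \<le> p"
  shows "prox_fun (p + 1) p x = (\<Sum>i\<in>UNIV. \<bar>x $ i\<bar> powr (p + 1) / (p + 1))"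
  using assms
  by (simp add: prox_fun_def lnorm_def powr_powr sum_nonneg flip: sum_divide_distrib)

lemma prox_kernel_prox_fun:
  fixes p r :: real
  assumes p: "1 \<le> p" and r: "r = 2 \<or> r = p + 1"
  shows "\<exists>d\<phi>. prox_kernel (prox_fun r p :: real ^ 'm \<Rightarrow> real) d\<phi> p (2 powr (1 - p))"
  using r
proof
  assume r: "r = 2"
  have "prox_kernel (prox_fun r p :: real ^ 'm \<Rightarrow> real) (\<lambda>x. norm x powr p *\<^sub>R sgn x) p (2 powr (1 - p))"
  proof
    show "\<exists>\<kappa>>0. \<forall>z::real ^ 'm. \<kappa> * norm z powr (p + 1) \<le> prox_fun r p z"
      by (rule prox_fun_growth) (use p r in auto)
    fix z w :: "real ^ 'm"
    show "prox_fun r p w + (norm w powr p *\<^sub>R sgn w) \<bullet> (z - w) + 2 powr (1 - p) * prox_fun r p (z - w)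
      \<le> prox_fun r p z"
      unfolding r prox_fun_euclidean by (rule norm_powr_uniformly_convex[OF p])
  qed (use p r in \<open>auto simp: continuous_on_norm_powr_sgn prox_fun_euclidean sgn_minus\<close>)
  then show ?thesis by blast
next
  assume r: "r = p + 1"
  have cont: "continuous_on UNIV (signed_powr p)"
    using continuous_on_norm_powr_sgn[of p, where 'a = real] p
    by (simp add: signed_powr_def[abs_def] mult.commute)
  have "prox_kernel (prox_fun r p :: real ^ 'm \<Rightarrow> real) (\<lambda>x. \<chi> i. signed_powr p (x $ i)) p (2 powr (1 - p))"
  proof
    show "\<exists>\<kappa>>0. \<forall>z::real ^ 'm. \<kappa> * norm z powr (p + 1) \<le> prox_fun r p z"
      by (rule prox_fun_growth) (use p r in auto)
    show "continuous_on UNIV (\<lambda>x::real ^ 'm. \<chi> i. signed_powr p (x $ i))"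
      by (intro continuous_intros continuous_on_compose2[OF cont]) auto
    fix z w :: "real ^ 'm"
    have "(\<Sum>i\<in>UNIV. \<bar>w $ i\<bar> powr (p + 1) / (p + 1) + signed_powr p (w $ i) * (z $ i - w $ i)
           + 2 powr (1 - p) * (\<bar>z $ i - w $ i\<bar> powr (p + 1) / (p + 1)))
        \<le> (\<Sum>i\<in>UNIV. \<bar>z $ i\<bar> powr (p + 1) / (p + 1))"
      by (intro sum_mono abs_powr_uniformly_convex p)
    then show "prox_fun r p w + (\<chi> i. signed_powr p (w $ i)) \<bullet> (z - w) + 2 powr (1 - p) * prox_fun r p (z - w)
      \<le> prox_fun r p z"
      unfolding r prox_fun_separable[OF p] by (simp add: inner_vec_def sum.distrib sum_distrib_left)
    show "prox_fun r p (- z) = prox_fun r p z"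
      by (simp add: prox_fun_def lnorm_def)
  qed (use p in \<open>auto simp: vec_eq_iff\<close>)
  then show ?thesis by blast
qed

lemma gradient_eqI:
  assumes "GDERIV h x :> D"
  shows "gradient h x = D"
  unfolding gradient_def
proof (rule the_equality)
  fix D' assume "GDERIV h x :> D'"
  then have "(\<lambda>v. v \<bullet> D') = (\<lambda>v. v \<bullet> D)"
    using assms unfolding gderiv_def by (rule has_derivative_unique)
  then show "D' = D"
    by (metis vector_eq_ldot)
qed (fact assms)

lemma GDERIV_eps_delta:
  fixes D :: "'a::real_inner"
  assumes "\<And>e. 0 < e \<Longrightarrow> \<exists>d>0. \<forall>z. norm (z - x) < d \<longrightarrow> \<bar>h z - h x - D \<bullet> (z - x)\<bar> \<le> e * norm (z - x)"
  shows "GDERIV h x :> D"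
  unfolding gderiv_def has_derivative_at_alt
  using assms by (auto simp: inner_commute bounded_linear_inner_left)

text \<open>A function squeezed between an affine function and a differentiable one that touch it at a point.\<close>

lemma GDERIV_sandwich:
  fixes D :: "'a::real_inner"
  assumes u: "GDERIV u x :> D" and eq: "u x = h x"
    and lower: "\<And>z. h x + D \<bullet> (z - x) \<le> h z" and upper: "\<And>z. h z \<le> u z"
  shows "GDERIV h x :> D"
proof (rule GDERIV_eps_delta)
  fix e :: real
  assume "0 < e"
  then obtain d where "0 < d"
    and d: "\<And>z. norm (z - x) < d \<Longrightarrow> \<bar>u z - u x - (z - x) \<bullet> D\<bar> \<le> e * norm (z - x)"
    using u unfolding gderiv_def has_derivative_at_alt by auto
  have "\<bar>h z - h x - D \<bullet> (z - x)\<bar> \<le> e * norm (z - x)" if "norm (z - x) < d" for z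
    using d[OF that] lower[of z] upper[of z] eq by (simp add: inner_commute)
  then show "\<exists>d>0. \<forall>z. norm (z - x) < d \<longrightarrow> \<bar>h z - h x - D \<bullet> (z - x)\<bar> \<le> e * norm (z - x)"
    using \<open>0 < d\<close> by blast
qed

context prox_kernel
begin

lemma nonneg: "0 \<le> \<phi> z"
proof -
  obtain \<kappa> where "0 < \<kappa>" "\<kappa> * norm z powr (p + 1) \<le> \<phi> z" using growth by blast
  moreover have "0 \<le> \<kappa> * norm z powr (p + 1)" using \<open>0 < \<kappa>\<close> by simp
  ultimately show ?thesis by linarith
qed

lemma pos: "z \<noteq> 0 \<Longrightarrow> 0 < \<phi> z"
proof -
  assume z: "z \<noteq> 0"
  obtain \<kappa> where "0 < \<kappa>" "\<kappa> * norm z powr (p + 1) \<le> \<phi> z" using growth by blast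
  moreover have "0 < \<kappa> * norm z powr (p + 1)" using \<open>0 < \<kappa>\<close> z by simp
  ultimately show ?thesis by linarith
qed

lemma gradient_ineq: "\<phi> w + d\<phi> w \<bullet> (z - w) \<le> \<phi> z"
  using uniformly_convex[of w z] nonneg[of "z - w"] c
  by (smt (verit) mult_nonneg_nonneg)

text \<open>The gradient inequality at \<open>w\<close> bounds the remainder below by \<open>0\<close>; at \<open>z\<close> it bounds it above by
\<open>(d\<phi> z - d\<phi> w) \<bullet> (z - w)\<close>.\<close>

lemma has_gradient: "GDERIV \<phi> w :> d\<phi> w"
proof (rule GDERIV_eps_delta)
  fix e :: real
  assume "0 < e"
  moreover have "isCont d\<phi> w"
    using grad_continuous by (simp add: continuous_on_eq_continuous_at)
  ultimately obtain d where "0 < d" and d: "\<And>z. norm (z - w) < d \<Longrightarrow> norm (d\<phi> z - d\<phi> w) < e"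
    unfolding continuous_at_eps_delta dist_norm by blast
  have "\<bar>\<phi> z - \<phi> w - d\<phi> w \<bullet> (z - w)\<bar> \<le> e * norm (z - w)" if "norm (z - w) < d" for z
  proof -
    have "\<phi> z - \<phi> w - d\<phi> w \<bullet> (z - w) \<le> (d\<phi> z - d\<phi> w) \<bullet> (z - w)"
      using gradient_ineq[of z w] by (simp add: inner_diff)
    also have "\<dots> \<le> norm (d\<phi> z - d\<phi> w) * norm (z - w)"
      by (rule norm_cauchy_schwarz)
    also have "\<dots> \<le> e * norm (z - w)"
      using d[OF that] by (intro mult_right_mono) auto
    finally show ?thesis using gradient_ineq[of w z] by simp
  qed
  then show "\<exists>d>0. \<forall>z. norm (z - w) < d \<longrightarrow> \<bar>\<phi> z - \<phi> w - d\<phi> w \<bullet> (z - w)\<bar> \<le> e * norm (z - w)"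
    using \<open>0 < d\<close> by blast
qed

lemma continuous: "continuous_on S \<phi>"
  using has_gradient unfolding gderiv_def
  by (meson continuous_at_imp_continuous_on has_derivative_continuous)

text \<open>The gradient inequality at the intermediate point, averaged.\<close>

lemma convex_combination:
  assumes "0 \<le> u" "0 \<le> v" "u + v = 1"
  shows "\<phi> (u *\<^sub>R a + v *\<^sub>R b) \<le> u * \<phi> a + v * \<phi> b"
proof -
  define m where "m = u *\<^sub>R a + v *\<^sub>R b"
  have "u * (\<phi> m + d\<phi> m \<bullet> (a - m)) + v * (\<phi> m + d\<phi> m \<bullet> (b - m)) \<le> u * \<phi> a + v * \<phi> b"
    using assms by (intro add_mono mult_left_mono gradient_ineq) auto
  moreover have "u * (\<phi> m + d\<phi> m \<bullet> (a - m)) + v * (\<phi> m + d\<phi> m \<bullet> (b - m))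
      = (u + v) * \<phi> m + d\<phi> m \<bullet> (m - (u + v) *\<^sub>R m)"
    by (simp add: m_def algebra_simps inner_simps)
  ultimately show ?thesis
    using assms by (simp add: m_def)
qed

lemma epi_scale_kernel:
  assumes "0 < lam"
  shows "prox_kernel (epi_scale lam \<phi>) (\<lambda>z. d\<phi> (inverse lam *\<^sub>R z)) p c"
proof
  show "\<exists>\<kappa>>0. \<forall>z. \<kappa> * norm z powr (p + 1) \<le> epi_scale lam \<phi> z"
  proof -
    obtain \<kappa> where \<kappa>: "0 < \<kappa>" "\<And>z. \<kappa> * norm z powr (p + 1) \<le> \<phi> z" using growth by blast
    have "lam * \<kappa> * inverse lam powr (p + 1) * norm z powr (p + 1) \<le> epi_scale lam \<phi> z" for z
      using mult_left_mono[OF \<kappa>(2)[of "inverse lam *\<^sub>R z"], of lam] assms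
      by (simp add: epi_scale_def powr_mult mult_ac)
    then show ?thesis
      using \<kappa>(1) assms by (intro exI[of _ "lam * \<kappa> * inverse lam powr (p + 1)"]) auto
  qed
  show "continuous_on UNIV (\<lambda>z. d\<phi> (inverse lam *\<^sub>R z))"
    by (intro continuous_on_compose2[OF grad_continuous] continuous_intros) auto
  have cancel: "lam * (inverse lam * t) = t" for t
    using assms by (simp flip: mult.assoc)
  fix z w
  show "epi_scale lam \<phi> w + d\<phi> (inverse lam *\<^sub>R w) \<bullet> (z - w) + c * epi_scale lam \<phi> (z - w)
      \<le> epi_scale lam \<phi> z"
    using mult_left_mono[OF uniformly_convex[of "inverse lam *\<^sub>R w" "inverse lam *\<^sub>R z"], of lam] assms
    by (simp add: epi_scale_def algebra_simps inner_simps cancel)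
qed (use p c in \<open>auto simp: epi_scale_def even odd\<close>)

text \<open>Near \<open>v = d\<phi> w\<close> the conjugate exceeds the affine function \<open>w \<bullet> u - \<phi> w\<close> at \<open>u\<close> by
at most the conjugate of \<open>c * \<phi>\<close> at \<open>u - v\<close>, and superlinear growth of \<open>\<phi>\<close> makes that conjugate
\<open>o(norm (u - v))\<close>.\<close>

lemma gradient_conjugate:
  "gradient (\<lambda>v. real_of_ereal (convex_conjugate (\<lambda>x. ereal (\<phi> x)) v)) (d\<phi> w) = w"
proof (rule gradient_eqI, rule GDERIV_eps_delta)
  define conj where "conj = convex_conjugate (\<lambda>x. ereal (\<phi> x))"
  define v where "v = d\<phi> w"
  have lower: "ereal (w \<bullet> u - \<phi> w) \<le> conj u" for u
    unfolding conj_def convex_conjugate_def by (rule SUP_upper2[of w]) auto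
  obtain \<kappa> where \<kappa>: "0 < \<kappa>" "\<And>z. \<kappa> * norm z powr (p + 1) \<le> \<phi> z" using growth by blast
  have upper: "conj u \<le> ereal (w \<bullet> u - \<phi> w + e * norm (u - v))"
    if e: "0 < e" and u: "norm (u - v) \<le> c * \<kappa> * e powr p" for e u
    unfolding conj_def convex_conjugate_def
  proof (rule SUP_least)
    fix x
    define d where "d = x - w"
    have "d \<bullet> (u - v) \<le> norm d * norm (u - v)"
      by (rule norm_cauchy_schwarz)
    also have "\<dots> \<le> e * norm (u - v) + c * \<kappa> * norm d powr (p + 1)"
    \<comment> \<open>Short displacements cost at most \<open>e * norm (u - v)\<close>; for long ones the power term wins,
        because \<open>norm (u - v)\<close> is at most \<open>c * \<kappa> * e powr p\<close>.\<close>
    proof (cases "norm d \<le> e")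
      case True
      then show ?thesis
        using c \<kappa>(1) by (intro add_increasing2 mult_right_mono) auto
    next
      case False
      then have d: "norm d powr (p + 1) = norm d * norm d powr p"
        by (simp add: powr_mult_base add.commute)
      have "norm (u - v) \<le> c * \<kappa> * norm d powr p"
        using u False e p c \<kappa>(1)
        by (elim order_trans) (intro mult_left_mono powr_mono2, auto)
      then have "norm d * norm (u - v) \<le> c * \<kappa> * norm d powr (p + 1)"
        unfolding d using mult_left_mono[of _ _ "norm d"] by (fastforce simp: mult_ac)
      then show ?thesis using e by (intro add_increasing) auto
    qed
    also have "c * \<kappa> * norm d powr (p + 1) \<le> c * \<phi> d"
      using mult_left_mono[OF \<kappa>(2)[of d], of c] c by (simp add: mult_ac)
    finally have "d \<bullet> (u - v) \<le> e * norm (u - v) + c * \<phi> d" by simp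
    moreover have "\<phi> w + v \<bullet> d + c * \<phi> d \<le> \<phi> x"
      using uniformly_convex[of w x] by (simp add: d_def v_def)
    moreover have "x \<bullet> u = w \<bullet> u + d \<bullet> (u - v) + v \<bullet> d"
      by (simp add: d_def inner_simps inner_commute)
    ultimately show "ereal (x \<bullet> u) - ereal (\<phi> x) \<le> ereal (w \<bullet> u - \<phi> w + e * norm (u - v))"
      by simp
  qed
  have at_v: "conj v = ereal (w \<bullet> v - \<phi> w)"
    using upper[of 1 v] lower[of v] c \<kappa>(1) by (intro antisym) auto
  fix e :: real
  assume e: "0 < e"
  have "\<bar>real_of_ereal (conj u) - real_of_ereal (conj v) - w \<bullet> (u - v)\<bar> \<le> e * norm (u - v)"
    if u: "norm (u - v) < c * \<kappa> * e powr p" for u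
  proof (cases "conj u")
    case (real r)
    then show ?thesis
      using upper[OF e, of u] u lower[of u] by (simp add: at_v inner_simps)
  qed (use upper[OF e, of u] lower[of u] u in auto)
  then show "\<exists>d>0. \<forall>z. norm (z - d\<phi> w) < d \<longrightarrow>
      \<bar>real_of_ereal (convex_conjugate (\<lambda>x. ereal (\<phi> x)) z)
        - real_of_ereal (convex_conjugate (\<lambda>x. ereal (\<phi> x)) (d\<phi> w)) - w \<bullet> (z - d\<phi> w)\<bar>
      \<le> e * norm (z - d\<phi> w)"
    using e c \<kappa>(1) unfolding conj_def v_def
    by (intro exI[of _ "c * \<kappa> * e powr p"]) auto
qed

end

section \<open>Proximal minimization\<close>

context prox_kernel
begin

text \<open>Finiteness at the minimizer is part of the notion: otherwise every point would be a minimizer of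
a function that is identically \<open>\<infinity>\<close>.\<close>

definition proximal_min :: "('b \<Rightarrow> ereal) \<Rightarrow> 'b \<Rightarrow> 'b \<Rightarrow> bool" where
  "proximal_min H y \<eta> \<longleftrightarrow>
     \<bar>H \<eta>\<bar> \<noteq> \<infinity> \<and> (\<forall>\<zeta>. H \<eta> + ereal (\<phi> (y - \<eta>)) \<le> H \<zeta> + ereal (\<phi> (y - \<zeta>)))"

text \<open>Compare \<open>\<eta>\<close> with points at parameter \<open>t\<close> on the segment to \<open>\<zeta>\<close>: convexity of \<open>H\<close> and the gradient
inequality leave a bound on the slope of \<open>\<phi>\<close>, and \<open>t\<close> tends to \<open>0\<close>.\<close>

lemma proximal_min_optimality:
  assumes conv: "convex_fun H" and min: "proximal_min H y \<eta>"
  shows "H \<eta> + ereal (d\<phi> (y - \<eta>) \<bullet> (\<zeta> - \<eta>)) \<le> H \<zeta>"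
proof (cases "H \<zeta>")
  case (real b)
  obtain a where a: "H \<eta> = ereal a"
    using min unfolding proximal_min_def by auto
  define w where "w = y - \<eta>"
  define d where "d = \<zeta> - \<eta>"
  have step: "d\<phi> (w - t *\<^sub>R d) \<bullet> d \<le> b - a" if t: "0 < t" "t < 1" for t
  proof -
    have "H (\<eta> + t *\<^sub>R d) \<le> ereal ((1 - t) * a + t * b)"
    proof -
      have "(1 - t) *\<^sub>R (\<eta>, a) + t *\<^sub>R (\<zeta>, b) \<in> {(x, s). H x \<le> ereal s}"
        using conv unfolding convex_fun_def
        by (rule convexD) (use t a real in auto)
      then show ?thesis by (simp add: d_def algebra_simps)
    qed
    moreover have "H \<eta> + ereal (\<phi> (y - \<eta>)) \<le> H (\<eta> + t *\<^sub>R d) + ereal (\<phi> (y - (\<eta> + t *\<^sub>R d)))"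
      using min unfolding proximal_min_def by blast
    ultimately have "ereal (a + \<phi> w) \<le> ereal ((1 - t) * a + t * b) + ereal (\<phi> (w - t *\<^sub>R d))"
      unfolding a w_def diff_diff_add[symmetric]
      by (smt (verit) add_right_mono order_trans plus_ereal.simps(1))
    then have "\<phi> w - \<phi> (w - t *\<^sub>R d) \<le> t * (b - a)"
      by (simp add: algebra_simps)
    moreover have "t * (d\<phi> (w - t *\<^sub>R d) \<bullet> d) \<le> \<phi> w - \<phi> (w - t *\<^sub>R d)"
      using gradient_ineq[of "w - t *\<^sub>R d" w] by simp
    ultimately show ?thesis
      using t by (smt (verit) mult_le_cancel_left_pos)
  qed
  have "isCont (\<lambda>t. d\<phi> (w - t *\<^sub>R d) \<bullet> d) 0"
    using continuous_on_compose2[OF grad_continuous, of UNIV "\<lambda>t. w - t *\<^sub>R d"]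
    by (intro continuous_intros) (auto simp: continuous_on_eq_continuous_at intro!: continuous_intros)
  then have "((\<lambda>t. d\<phi> (w - t *\<^sub>R d) \<bullet> d) \<longlongrightarrow> d\<phi> w \<bullet> d) (at_right 0)"
    by (simp add: isCont_def filterlim_at_split)
  moreover have "\<forall>\<^sub>F t in at_right 0. d\<phi> (w - t *\<^sub>R d) \<bullet> d \<le> b - a"
    unfolding eventually_at_right_field using step by (intro exI[of _ 1]) auto
  ultimately have "d\<phi> w \<bullet> d \<le> b - a"
    by (rule tendsto_upperbound) simp
  then show ?thesis
    using a real by (simp add: w_def d_def)
next
  case MInf
  then show ?thesis
    using min unfolding proximal_min_def by (cases "H \<eta>") (auto dest!: spec[of _ \<zeta>])
qed simp

text \<open>The optimality condition for \<open>H\<close> is added to uniform convexity of the kernel.\<close>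

lemma proximal_min_growth:
  assumes conv: "convex_fun H" and min: "proximal_min H y \<eta>"
  shows "H \<eta> + ereal (\<phi> (y - \<eta>)) + ereal (c * \<phi> (\<zeta> - \<eta>)) \<le> H \<zeta> + ereal (\<phi> (y - \<zeta>))"
proof -
  have "\<phi> (y - \<eta>) + c * \<phi> (\<zeta> - \<eta>) \<le> d\<phi> (y - \<eta>) \<bullet> (\<zeta> - \<eta>) + \<phi> (y - \<zeta>)"
    using uniformly_convex[of "y - \<eta>" "y - \<zeta>"] even[of "\<zeta> - \<eta>"] by (simp add: inner_simps)
  then have "H \<eta> + ereal (\<phi> (y - \<eta>) + c * \<phi> (\<zeta> - \<eta>))
      \<le> H \<eta> + ereal (d\<phi> (y - \<eta>) \<bullet> (\<zeta> - \<eta>) + \<phi> (y - \<zeta>))"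
    by (intro add_left_mono) simp
  also have "\<dots> = H \<eta> + ereal (d\<phi> (y - \<eta>) \<bullet> (\<zeta> - \<eta>)) + ereal (\<phi> (y - \<zeta>))"
    by (simp add: add.assoc)
  also have "\<dots> \<le> H \<zeta> + ereal (\<phi> (y - \<zeta>))"
    by (intro add_right_mono proximal_min_optimality conv min)
  finally show ?thesis by (simp add: add.assoc)
qed

lemma proximal_min_unique:
  assumes conv: "convex_fun H" and min: "proximal_min H y \<eta>"
    and le: "H \<zeta> + ereal (\<phi> (y - \<zeta>)) \<le> H \<eta> + ereal (\<phi> (y - \<eta>))"
  shows "\<zeta> = \<eta>"
proof (rule ccontr)
  assume "\<zeta> \<noteq> \<eta>"
  then have "0 < c * \<phi> (\<zeta> - \<eta>)" using pos[of "\<zeta> - \<eta>"] c by simp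
  moreover have "H \<eta> + ereal (\<phi> (y - \<eta>)) + ereal (c * \<phi> (\<zeta> - \<eta>)) \<le> H \<eta> + ereal (\<phi> (y - \<eta>))"
    using proximal_min_growth[OF conv min] le by (rule order_trans)
  ultimately show False
    using min unfolding proximal_min_def by (cases "H \<eta>") auto
qed

lemma prox_map_eq:
  assumes conv: "convex_fun H" and min: "proximal_min H y \<eta>"
  shows "prox_map H \<phi> y = \<eta>"
  unfolding prox_map_def
proof (rule the_equality)
  show "is_arg_min (\<lambda>\<zeta>. H \<zeta> + ereal (\<phi> (y - \<zeta>))) (\<lambda>_. True) \<eta>"
    using min by (auto simp: proximal_min_def is_arg_min_def not_less)
  fix \<zeta> assume "is_arg_min (\<lambda>\<zeta>. H \<zeta> + ereal (\<phi> (y - \<zeta>))) (\<lambda>_. True) \<zeta>"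
  then show "\<zeta> = \<eta>"
    by (intro proximal_min_unique[OF conv min]) (auto simp: is_arg_min_def not_less)
qed

text \<open>Beyond distance \<open>1\<close> from \<open>y\<close> the kernel grows at least quadratically because \<open>2 \<le> p + 1\<close>.\<close>

lemma affine_perturbation_bounded:
  "\<exists>R. \<forall>\<zeta>. a + b \<bullet> \<zeta> + \<phi> (y - \<zeta>) \<le> C \<longrightarrow> norm \<zeta> \<le> R"
proof -
  obtain \<kappa> where \<kappa>: "0 < \<kappa>" "\<And>z. \<kappa> * norm z powr (p + 1) \<le> \<phi> z" using growth by blast
  define M where "M = \<bar>C - a - b \<bullet> y\<bar> + norm b"
  have "norm \<zeta> \<le> norm y + max 1 (M / \<kappa>)" if le: "a + b \<bullet> \<zeta> + \<phi> (y - \<zeta>) \<le> C" for \<zeta>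
  proof -
    define t where "t = norm (y - \<zeta>)"
    have "t \<le> max 1 (M / \<kappa>)"
    proof (cases "t \<le> 1")
      case False
      have "b \<bullet> (y - \<zeta>) \<le> norm b * t"
        unfolding t_def by (rule norm_cauchy_schwarz)
      then have "\<phi> (y - \<zeta>) \<le> \<bar>C - a - b \<bullet> y\<bar> + norm b * t"
        using le by (simp add: inner_diff_right)
      also have "\<dots> \<le> \<bar>C - a - b \<bullet> y\<bar> * t + norm b * t"
        using False mult_left_mono[of 1 t "\<bar>C - a - b \<bullet> y\<bar>"] by simp
      also have "\<dots> = M * t"
        by (simp add: M_def algebra_simps)
      finally have "\<kappa> * t powr (p + 1) \<le> M * t"
        using \<kappa>(2)[of "y - \<zeta>"] by (simp add: t_def)
      moreover have "\<kappa> * t powr 2 \<le> \<kappa> * t powr (p + 1)"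
        using \<kappa>(1) p False by (intro mult_left_mono powr_mono) auto
      moreover have "t powr 2 = t * t"
        using False by (simp add: power2_eq_square)
      ultimately have "(\<kappa> * t) * t \<le> M * t"
        by (simp only: mult.assoc)
      then have "\<kappa> * t \<le> M"
        by (rule mult_right_le_imp_le) (use False in simp)
      then have "t \<le> M / \<kappa>"
        using False \<kappa>(1) by (simp add: pos_le_divide_eq mult.commute)
      then show ?thesis by simp
    qed simp
    then show ?thesis
      using norm_triangle_ineq4[of y "y - \<zeta>"] by (simp add: t_def)
  qed
  then show ?thesis by blast
qed

text \<open>For a lower semicontinuous \<open>H\<close>, expressed by a closed epigraph, the minimum is taken over pairs
\<open>(\<zeta>, t)\<close> in the epigraph, on which the objective \<open>t + \<phi> (y - \<zeta>)\<close> is real-valued and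
continuous. The affine minorant makes its sublevel sets bounded, in \<open>t\<close> too.\<close>

lemma proximal_min_exists:
  assumes closed: "closed {(x, t::real). H x \<le> ereal t}"
    and minorant: "\<And>\<zeta>. ereal (a + b \<bullet> \<zeta>) \<le> H \<zeta>"
    and finite: "H \<eta>0 < \<infinity>"
  shows "\<exists>\<eta>. proximal_min H y \<eta>"
proof -
  obtain t0 where t0: "H \<eta>0 = ereal t0"
    using minorant[of \<eta>0] finite by (cases "H \<eta>0") auto
  define C where "C = t0 + \<phi> (y - \<eta>0)"
  define F where "F = (\<lambda>(\<zeta>, t). t + \<phi> (y - \<zeta>))"
  define S where "S = {(x, t::real). H x \<le> ereal t} \<inter> {z. F z \<le> C}"
  have cF: "continuous_on UNIV F"
    unfolding F_def case_prod_beta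
    by (intro continuous_intros continuous_on_compose2[OF continuous]) auto
  have "closed S"
    unfolding S_def by (intro closed_Int closed closed_Collect_le cF continuous_intros)
  moreover obtain R where R: "\<And>\<zeta>. a + b \<bullet> \<zeta> + \<phi> (y - \<zeta>) \<le> C \<Longrightarrow> norm \<zeta> \<le> R"
    using affine_perturbation_bounded by blast
  have "norm z \<le> R + (\<bar>C\<bar> + \<bar>a\<bar> + norm b * R)" if z: "z \<in> S" for z
  proof -
    obtain \<zeta> t where zt: "z = (\<zeta>, t)" by (cases z)
    have t: "a + b \<bullet> \<zeta> \<le> t"
      using order_trans[OF minorant[of \<zeta>], of "ereal t"] z by (simp add: S_def zt)
    have tC: "t + \<phi> (y - \<zeta>) \<le> C" using z by (simp add: S_def zt F_def)
    have n: "norm \<zeta> \<le> R" using t tC by (intro R) simp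
    have "- (b \<bullet> \<zeta>) \<le> norm b * norm \<zeta>"
      using norm_cauchy_schwarz[of "- b" \<zeta>] by simp
    also have "\<dots> \<le> norm b * R"
      using n by (intro mult_left_mono) auto
    finally have "\<bar>t\<bar> \<le> \<bar>C\<bar> + \<bar>a\<bar> + norm b * R"
      using t tC nonneg[of "y - \<zeta>"] n by (smt (verit) mult_nonneg_nonneg norm_ge_zero)
    then show ?thesis
      using norm_Pair_le[of \<zeta> t] n by (simp add: zt)
  qed
  then have "bounded S" unfolding bounded_iff by (intro exI ballI)
  ultimately have "compact S" by (simp add: compact_eq_bounded_closed)
  moreover have "(\<eta>0, t0) \<in> S" by (simp add: S_def F_def C_def t0)
  moreover have "continuous_on S F" using cF continuous_on_subset by blast
  ultimately obtain z where "z \<in> S" and z: "\<And>z'. z' \<in> S \<Longrightarrow> F z \<le> F z'"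
    using continuous_attains_inf[of S F] by blast
  obtain \<eta> s where zs: "z = (\<eta>, s)" by (cases z)
  have \<eta>: "H \<eta> \<le> ereal s" "s + \<phi> (y - \<eta>) \<le> C"
    using \<open>z \<in> S\<close> by (auto simp: S_def F_def zs)
  have "ereal s + ereal (\<phi> (y - \<eta>)) \<le> H \<zeta> + ereal (\<phi> (y - \<zeta>))" for \<zeta>
  proof (cases "H \<zeta>")
    case (real t)
    show ?thesis
    proof (cases "t + \<phi> (y - \<zeta>) \<le> C")
      case True
      then have "(\<zeta>, t) \<in> S" by (simp add: S_def F_def real)
      then show ?thesis using z[of "(\<zeta>, t)"] by (simp add: F_def zs real)
    next
      case False
      then show ?thesis using \<eta>(2) by (simp add: real)
    qed
  qed (use minorant[of \<zeta>] in auto)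
  moreover have "H \<eta> + ereal (\<phi> (y - \<eta>)) \<le> ereal s + ereal (\<phi> (y - \<eta>))"
    using \<eta>(1) by (rule add_right_mono)
  moreover have "\<bar>H \<eta>\<bar> \<noteq> \<infinity>"
    using \<eta>(1) minorant[of \<eta>] by auto
  ultimately show ?thesis
    unfolding proximal_min_def by (meson order_trans)
qed

end

text \<open>Growth turns smallness of the kernel into convergence of its argument.\<close>

lemma (in prox_kernel) tendsto_zero_if_value_tendsto_zero:
  assumes "((\<lambda>i. \<phi> (z i)) \<longlongrightarrow> 0) F"
  shows "(z \<longlongrightarrow> 0) F"
proof (rule tendstoI)
  fix e :: real
  assume e: "0 < e"
  obtain \<kappa> where \<kappa>: "0 < \<kappa>" "\<And>z. \<kappa> * norm z powr (p + 1) \<le> \<phi> z" using growth by blast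
  have "\<forall>\<^sub>F i in F. \<phi> (z i) < \<kappa> * e powr (p + 1)"
    using assms \<kappa>(1) e by (intro order_tendstoD) auto
  then show "\<forall>\<^sub>F i in F. dist (z i) 0 < e"
  proof (rule eventually_mono)
    fix i assume "\<phi> (z i) < \<kappa> * e powr (p + 1)"
    then have "\<kappa> * norm (z i) powr (p + 1) < \<kappa> * e powr (p + 1)"
      using \<kappa>(2)[of "z i"] by linarith
    then have "norm (z i) powr (p + 1) < e powr (p + 1)"
      using \<kappa>(1) by simp
    then have "norm (z i) < e"
      using e p powr_mono2[of "p + 1" e "norm (z i)"] by fastforce
    then show "dist (z i) 0 < e" by simp
  qed
qed

lemma le_INF_add_ereal:
  fixes h :: "'a \<Rightarrow> ereal"
  shows "a \<le> (INF x. h x) + ereal e \<longleftrightarrow> (\<forall>x. a \<le> h x + ereal e)"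
proof -
  have "a \<le> b + ereal e \<longleftrightarrow> a - ereal e \<le> b" for b
    by (cases a; cases b) auto
  then show ?thesis by (simp add: le_INF_iff)
qed

lemma convex_funD:
  assumes "convex_fun h" "h a \<le> ereal s" "h b \<le> ereal t" "0 \<le> u" "0 \<le> v" "u + v = 1"
  shows "h (u *\<^sub>R a + v *\<^sub>R b) \<le> ereal (u * s + v * t)"
  using convexD[OF assms(1)[unfolded convex_fun_def], of "(a, s)" "(b, t)" u v] assms by simp

lemma (in prox_kernel) perturbed_convex:
  assumes H: "convex_fun H"
    and a: "H a \<le> ereal (s - \<phi> (y - a))" and b: "H b \<le> ereal (t - \<phi> (y - b))"
    and uv: "0 \<le> u" "0 \<le> v" "u + v = 1"
  shows "H (u *\<^sub>R a + v *\<^sub>R b) \<le> ereal (u * s + v * t - \<phi> (y - (u *\<^sub>R a + v *\<^sub>R b)))"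
proof -
  have "y - (u *\<^sub>R a + v *\<^sub>R b) = u *\<^sub>R (y - a) + v *\<^sub>R (y - b)"
    using uv by (simp add: algebra_simps flip: scaleR_add_left)
  then have "\<phi> (y - (u *\<^sub>R a + v *\<^sub>R b)) \<le> u * \<phi> (y - a) + v * \<phi> (y - b)"
    using convex_combination[OF uv] by simp
  then have "u * (s - \<phi> (y - a)) + v * (t - \<phi> (y - b)) \<le> u * s + v * t - \<phi> (y - (u *\<^sub>R a + v *\<^sub>R b))"
    by (simp add: algebra_simps)
  with convex_funD[OF H a b uv] show ?thesis
    by (meson ereal_less_eq(3) order_trans)
qed

section \<open>The augmented Lagrangian of a convex-concave function\<close>

text \<open>
The properties of the Lagrangian on which the argument depends. The functions \<open>- L x\<close> for \<open>x \<in> X\<close> are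
closed and convex, have an affine minorant and share one effective domain; this common domain lets
convex combinations in \<open>x\<close> be formed without meeting \<open>\<infinity> - \<infinity>\<close>.
\<close>

locale augmented_saddle = prox_kernel \<phi> d\<phi> p c
  for \<phi> :: "real ^ 'm \<Rightarrow> real" and d\<phi> and p c :: real +
  fixes L :: "'a::real_inner \<Rightarrow> real ^ 'm \<Rightarrow> ereal" and X :: "'a set"
  assumes convex_x: "convex_fun (\<lambda>x. L x \<eta>)"
    and dom_x: "L x \<eta> < \<infinity> \<longleftrightarrow> x \<in> X"
    and convex_neg: "x \<in> X \<Longrightarrow> convex_fun (\<lambda>\<eta>. - L x \<eta>)"
    and closed_neg: "x \<in> X \<Longrightarrow> closed {(\<eta>, t::real). - L x \<eta> \<le> ereal t}"
    and minorant: "x \<in> X \<Longrightarrow> \<exists>a b. \<forall>\<eta>. ereal (a + b \<bullet> \<eta>) \<le> - L x \<eta>"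
    and common_domain: "x \<in> X \<Longrightarrow> x' \<in> X \<Longrightarrow> L x \<eta> \<noteq> - \<infinity> \<Longrightarrow> L x' \<eta> \<noteq> - \<infinity>"
    and nonempty: "X \<noteq> {}"
    and dual_proper: "\<exists>\<eta>. dual_fun L \<eta> \<noteq> - \<infinity>"
begin

lemma convex_X: "convex X"
proof (rule convexI)
  fix x x' :: 'a and u v :: real
  assume *: "x \<in> X" "x' \<in> X" "0 \<le> u" "0 \<le> v" "u + v = 1"
  obtain s where s: "L x 0 \<le> ereal s" using dom_x[of x 0] * by (cases "L x 0") auto
  obtain t where t: "L x' 0 \<le> ereal t" using dom_x[of x' 0] * by (cases "L x' 0") auto
  have "L (u *\<^sub>R x + v *\<^sub>R x') 0 < \<infinity>"
    using convex_funD[OF convex_x s t *(3-5)] by (rule le_less_trans) simp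
  then show "u *\<^sub>R x + v *\<^sub>R x' \<in> X" using dom_x by blast
qed

lemma dual_fun_le: "dual_fun L \<eta> \<le> L x \<eta>"
  unfolding dual_fun_def by (rule INF_lower) simp

text \<open>The epigraph of \<open>- dual_fun L\<close> is the intersection of those of \<open>- L x\<close>, whence its closedness and convexity.\<close>

lemma neg_dual_le_iff: "- dual_fun L \<eta> \<le> t \<longleftrightarrow> (\<forall>x\<in>X. - L x \<eta> \<le> t)"
proof -
  have "- dual_fun L \<eta> \<le> t \<longleftrightarrow> - t \<le> (INF x. L x \<eta>)"
    unfolding dual_fun_def by (metis ereal_minus_le_minus ereal_uminus_uminus)
  also have "\<dots> \<longleftrightarrow> (\<forall>x. - t \<le> L x \<eta>)" by (simp add: le_INF_iff)
  also have "\<dots> \<longleftrightarrow> (\<forall>x\<in>X. - t \<le> L x \<eta>)"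
    using dom_x by (metis less_ereal.simps(2) linorder_not_less ereal_infty_less(1) ereal_less_eq(1))
  also have "\<dots> \<longleftrightarrow> (\<forall>x\<in>X. - L x \<eta> \<le> t)"
    by (metis ereal_minus_le_minus ereal_uminus_uminus)
  finally show ?thesis .
qed

lemma domain_point:
  obtains \<eta> where "dual_fun L \<eta> \<noteq> - \<infinity>" "\<And>x. L x \<eta> \<noteq> - \<infinity>"
  using dual_proper dual_fun_le by (metis ereal_infty_less_eq(2))

lemma neg_dual_convex: "convex_fun (\<lambda>\<eta>. - dual_fun L \<eta>)"
proof -
  have "{(\<eta>, t::real). - dual_fun L \<eta> \<le> ereal t} = (\<Inter>x\<in>X. {(\<eta>, t). - L x \<eta> \<le> ereal t})"
    by (auto simp: neg_dual_le_iff)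
  then show ?thesis
    using convex_neg unfolding convex_fun_def by (auto intro!: convex_INT)
qed

lemma neg_dual_closed: "closed {(\<eta>, t::real). - dual_fun L \<eta> \<le> ereal t}"
proof -
  have "{(\<eta>, t::real). - dual_fun L \<eta> \<le> ereal t} = (\<Inter>x\<in>X. {(\<eta>, t). - L x \<eta> \<le> ereal t})"
    by (auto simp: neg_dual_le_iff)
  then show ?thesis using closed_neg by (auto intro!: closed_INT)
qed

lemma aug_maximizer_exists:
  assumes x: "x \<in> X"
  shows "\<exists>\<eta>. proximal_min (\<lambda>\<zeta>. - L x \<zeta>) y \<eta>"
proof -
  obtain a b where ab: "\<And>\<eta>. ereal (a + b \<bullet> \<eta>) \<le> - L x \<eta>" using minorant[OF x] by blast
  obtain \<eta>0 where "L x \<eta>0 \<noteq> - \<infinity>" using domain_point by blast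
  then have "- L x \<eta>0 < \<infinity>" by (cases "L x \<eta>0") auto
  then show ?thesis using closed_neg[OF x] ab by (intro proximal_min_exists)
qed

lemma dual_prox_exists: "\<exists>\<eta>. proximal_min (\<lambda>\<zeta>. - dual_fun L \<zeta>) y \<eta>"
proof -
  obtain x where x: "x \<in> X" using nonempty by blast
  obtain a b where ab: "\<And>\<eta>. ereal (a + b \<bullet> \<eta>) \<le> - L x \<eta>" using minorant[OF x] by blast
  have ab': "ereal (a + b \<bullet> \<eta>) \<le> - dual_fun L \<eta>" for \<eta>
    using ab[of \<eta>] neg_dual_le_iff[of \<eta> "- dual_fun L \<eta>"] x by (auto intro: order_trans)
  obtain \<eta>0 where "dual_fun L \<eta>0 \<noteq> - \<infinity>" using domain_point by blast
  then have "- dual_fun L \<eta>0 < \<infinity>" by (cases "dual_fun L \<eta>0") auto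
  then show ?thesis using neg_dual_closed ab' by (intro proximal_min_exists)
qed

lemma aug_lagrangian_eq:
  assumes "proximal_min (\<lambda>\<zeta>. - L x \<zeta>) y \<eta>"
  shows "aug_lagrangian L \<phi> x y = L x \<eta> - ereal (\<phi> (y - \<eta>))"
  unfolding aug_lagrangian_def
proof (rule antisym, rule SUP_least)
  fix \<zeta>
  have "- L x \<eta> + ereal (\<phi> (y - \<eta>)) \<le> - L x \<zeta> + ereal (\<phi> (y - \<zeta>))" "\<bar>L x \<eta>\<bar> \<noteq> \<infinity>"
    using assms by (auto simp: proximal_min_def)
  then show "L x \<zeta> - ereal (\<phi> (y - \<zeta>)) \<le> L x \<eta> - ereal (\<phi> (y - \<eta>))"
    by (cases "L x \<eta>"; cases "L x \<zeta>") auto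
qed (rule SUP_upper, simp)

lemma aug_lagrangian_ge: "L x \<eta> - ereal (\<phi> (y - \<eta>)) \<le> aug_lagrangian L \<phi> x y"
  unfolding aug_lagrangian_def by (rule SUP_upper) simp

lemma aug_lagrangian_outside: "x \<notin> X \<Longrightarrow> aug_lagrangian L \<phi> x y = \<infinity>"
  using aug_lagrangian_ge[of x 0 y] dom_x[of x 0] by auto

lemma aug_lagrangian_finite: "x \<in> X \<Longrightarrow> \<bar>aug_lagrangian L \<phi> x y\<bar> \<noteq> \<infinity>"
proof -
  assume "x \<in> X"
  then obtain \<eta> where \<eta>: "proximal_min (\<lambda>\<zeta>. - L x \<zeta>) y \<eta>"
    using aug_maximizer_exists by blast
  then show ?thesis
    unfolding aug_lagrangian_eq[OF \<eta>] by (cases "L x \<eta>") (auto simp: proximal_min_def)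
qed

text \<open>The negative of the augmented Lagrangian is a Moreau envelope. At \<open>y\<close> it is touched from above by
\<open>z \<mapsto> - L x \<eta> + \<phi> (z - \<eta>)\<close>, the objective with \<open>\<eta>\<close> frozen, and from below by an affine function
obtained by adding the optimality condition at \<open>\<eta>\<close> to the gradient inequality.\<close>

lemma grad_y_aug_lagrangian:
  assumes x: "x \<in> X" and min: "proximal_min (\<lambda>\<zeta>. - L x \<zeta>) y \<eta>"
  shows "grad_y (aug_lagrangian L \<phi>) x y = - d\<phi> (y - \<eta>)"
  unfolding grad_y_def
proof (rule gradient_eqI)
  define E where "E = (\<lambda>z. - real_of_ereal (aug_lagrangian L \<phi> x z))"
  obtain l where l: "L x \<eta> = ereal l"
    using min by (auto simp: proximal_min_def)
  have Ey: "E y = - l + \<phi> (y - \<eta>)"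
    unfolding E_def aug_lagrangian_eq[OF min] by (simp add: l)
  have "GDERIV E y :> d\<phi> (y - \<eta>)"
  proof (rule GDERIV_sandwich)
    have "GDERIV (\<lambda>z. \<phi> (z - \<eta>)) y :> d\<phi> (y - \<eta>)"
    proof -
      have "((\<lambda>z. z - \<eta>) has_derivative (\<lambda>h. h)) (at y)"
        by (auto intro!: derivative_eq_intros)
      then show ?thesis
        unfolding gderiv_def by (rule has_derivative_compose[OF _ has_gradient[unfolded gderiv_def]])
    qed
    then show "GDERIV (\<lambda>z. - l + \<phi> (z - \<eta>)) y :> d\<phi> (y - \<eta>)"
      using GDERIV_add[OF GDERIV_const[of "- l"]] by fastforce
    show "- l + \<phi> (y - \<eta>) = E y" by (simp add: Ey)
    fix z
    obtain \<zeta> where \<zeta>: "proximal_min (\<lambda>\<zeta>. - L x \<zeta>) z \<zeta>"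
      using aug_maximizer_exists[OF x] by blast
    obtain m where m: "L x \<zeta> = ereal m"
      using \<zeta> by (auto simp: proximal_min_def)
    have Ez: "E z = - m + \<phi> (z - \<zeta>)"
      unfolding E_def aug_lagrangian_eq[OF \<zeta>] by (simp add: m)
    show "E z \<le> - l + \<phi> (z - \<eta>)"
      using \<zeta> unfolding proximal_min_def Ez by (auto simp: m l dest: spec[of _ \<eta>])
    have "- l + d\<phi> (y - \<eta>) \<bullet> (\<zeta> - \<eta>) \<le> - m"
      using proximal_min_optimality[OF convex_neg[OF x] min, of \<zeta>] by (simp add: l m)
    moreover have "\<phi> (y - \<eta>) + d\<phi> (y - \<eta>) \<bullet> ((z - \<zeta>) - (y - \<eta>)) \<le> \<phi> (z - \<zeta>)"
      by (rule gradient_ineq)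
    ultimately show "E y + d\<phi> (y - \<eta>) \<bullet> (z - y) \<le> E z"
      unfolding Ey Ez by (simp add: inner_simps)
  qed
  then show "GDERIV (\<lambda>z. real_of_ereal (aug_lagrangian L \<phi> x z)) y :> - d\<phi> (y - \<eta>)"
    using GDERIV_minus[of E y "d\<phi> (y - \<eta>)"] by (simp add: E_def)
qed

text \<open>The finite case of the minimax inequality. Were the claim false, the convex set \<open>S\<close> of slack
vectors \<open>t\<close> would miss the nonnegative orthant. The normal \<open>\<mu>\<close> of a separating hyperplane is nonnegative;
normalized, it weights the points \<open>xs i\<close> into a point \<open>x\<close> at which, by convexity of \<open>L\<close> in its first
argument, the objective stays at or above \<open>\<gamma>\<close> for every \<open>\<eta>\<close>.\<close>

lemma common_sublevel_point_finite:
  fixes xs :: "'i::finite \<Rightarrow> 'a"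
  assumes xs: "\<And>i. xs i \<in> X"
    and below: "\<And>x. x \<in> X \<Longrightarrow> \<exists>\<eta>. - L x \<eta> + ereal (\<phi> (y - \<eta>)) < ereal \<gamma>"
  shows "\<exists>\<eta>. \<forall>i. - L (xs i) \<eta> \<le> ereal (\<gamma> - \<phi> (y - \<eta>))"
proof (rule ccontr)
  assume none: "\<not> ?thesis"
  define S where "S = {t :: real ^ 'i. \<exists>\<eta>. \<forall>i. - L (xs i) \<eta> \<le> ereal (\<gamma> - \<phi> (y - \<eta>) - t $ i)}"
  define P where "P = {t :: real ^ 'i. \<forall>i. 0 \<le> t $ i}"
  have S_mem: "(\<chi> i. \<gamma> - \<phi> (y - \<eta>) + real_of_ereal (L (xs i) \<eta>)) \<in> S"
    if "\<And>i. \<bar>L (xs i) \<eta>\<bar> \<noteq> \<infinity>" for \<eta>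
  proof -
    have "- L (xs i) \<eta> \<le> ereal (- real_of_ereal (L (xs i) \<eta>))" for i
      using that[of i] by (cases "L (xs i) \<eta>") auto
    then show ?thesis unfolding S_def by (auto intro!: exI[of _ \<eta>])
  qed
  have finite_L: "\<bar>L (xs i) \<eta>\<bar> \<noteq> \<infinity>" if "x \<in> X" "L x \<eta> \<noteq> - \<infinity>" for x \<eta> i
    using common_domain[OF that(1) xs that(2)] dom_x[of "xs i" \<eta>] xs by fastforce
  have "convex S"
  proof (rule convexI)
    fix s t :: "real ^ 'i" and u v :: real
    assume st: "s \<in> S" "t \<in> S" and uv: "0 \<le> u" "0 \<le> v" "u + v = 1"
    obtain a where a: "\<And>i. - L (xs i) a \<le> ereal (\<gamma> - \<phi> (y - a) - s $ i)"
      using st by (auto simp: S_def)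
    obtain b where b: "\<And>i. - L (xs i) b \<le> ereal (\<gamma> - \<phi> (y - b) - t $ i)"
      using st by (auto simp: S_def)
    have "- L (xs i) (u *\<^sub>R a + v *\<^sub>R b)
        \<le> ereal (\<gamma> - \<phi> (y - (u *\<^sub>R a + v *\<^sub>R b)) - (u *\<^sub>R s + v *\<^sub>R t) $ i)" for i
    proof -
      have "- L (xs i) (u *\<^sub>R a + v *\<^sub>R b)
          \<le> ereal (u * (\<gamma> - s $ i) + v * (\<gamma> - t $ i) - \<phi> (y - (u *\<^sub>R a + v *\<^sub>R b)))"
        using a[of i] b[of i] by (intro perturbed_convex convex_neg xs uv) (simp_all add: algebra_simps)
      moreover have "u * (\<gamma> - s $ i) + v * (\<gamma> - t $ i) = (u + v) * \<gamma> - (u *\<^sub>R s + v *\<^sub>R t) $ i"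
        by (simp add: algebra_simps)
      ultimately show ?thesis using uv by (simp add: algebra_simps)
    qed
    then show "u *\<^sub>R s + v *\<^sub>R t \<in> S" by (auto simp: S_def)
  qed
  moreover have "convex P"
    unfolding P_def by (rule convexI) auto
  moreover have "S \<noteq> {}"
    using domain_point S_mem finite_L[OF xs] by (metis empty_iff)
  moreover have "P \<noteq> {}"
    unfolding P_def by (auto intro!: exI[of _ 0])
  moreover have "S \<inter> P = {}"
  proof -
    have False if s: "s \<in> S" "s \<in> P" for s
    proof -
      obtain a where a: "\<And>i. - L (xs i) a \<le> ereal (\<gamma> - \<phi> (y - a) - s $ i)"
        using s(1) by (auto simp: S_def)
      have "- L (xs i) a \<le> ereal (\<gamma> - \<phi> (y - a))" for i
        using s(2) by (intro order_trans[OF a[of i]]) (simp add: P_def)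
      then show False using none by blast
    qed
    then show ?thesis by blast
  qed
  ultimately obtain \<mu> \<beta> where "\<mu> \<noteq> 0"
    and S_le: "\<And>s. s \<in> S \<Longrightarrow> \<mu> \<bullet> s \<le> \<beta>" and P_ge: "\<And>s. s \<in> P \<Longrightarrow> \<beta> \<le> \<mu> \<bullet> s"
    using separating_hyperplane_sets[of S P] by blast
  have "\<beta> \<le> 0" using P_ge[of 0] by (simp add: P_def)
  have \<mu>: "0 \<le> \<mu> $ i" for i
  proof (rule ccontr)
    assume neg: "\<not> 0 \<le> \<mu> $ i"
    define t where "t = (\<bar>\<beta>\<bar> + 1) / \<bar>\<mu> $ i\<bar>"
    have "t * \<mu> $ i = - (\<bar>\<beta>\<bar> + 1)" using neg by (simp add: t_def field_simps)
    moreover have "0 \<le> t" by (simp add: t_def)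
    then have "axis i t \<in> P" by (auto simp: P_def axis_def)
    ultimately show False
      using P_ge[of "axis i t"] by (simp add: inner_axis mult.commute)
  qed
  define M where "M = (\<Sum>i\<in>UNIV. \<mu> $ i)"
  have "M > 0"
    using \<open>\<mu> \<noteq> 0\<close> \<mu> unfolding M_def
    by (metis (no_types, lifting) UNIV_I finite_class.finite_UNIV less_eq_real_def sum_nonneg sum_nonneg_eq_0_iff vec_eq_iff zero_index)
  define w where "w = (\<lambda>i. \<mu> $ i / M)"
  have w: "\<And>i. 0 \<le> w i" "sum w UNIV = 1"
    using \<mu> \<open>M > 0\<close> by (auto simp: w_def M_def simp flip: sum_divide_distrib)
  define x where "x = (\<Sum>i\<in>UNIV. w i *\<^sub>R xs i)"
  have x: "x \<in> X"
    unfolding x_def by (intro convex_sum convex_X) (use w xs in auto)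
  then obtain \<eta> where \<eta>: "- L x \<eta> + ereal (\<phi> (y - \<eta>)) < ereal \<gamma>"
    using below by blast
  then have "L x \<eta> \<noteq> - \<infinity>" by auto
  then have fin: "\<bar>L (xs i) \<eta>\<bar> \<noteq> \<infinity>" for i by (rule finite_L[OF x])
  define l where "l = (\<lambda>i. real_of_ereal (L (xs i) \<eta>))"
  have "(\<Sum>i\<in>UNIV. w i *\<^sub>R (xs i, l i)) \<in> {(x, t). L x \<eta> \<le> ereal t}"
    using convex_x[of \<eta>, unfolded convex_fun_def]
    by (intro convex_sum) (use w fin in \<open>auto simp: l_def ereal_real\<close>)
  then have "L x \<eta> \<le> ereal (\<Sum>i\<in>UNIV. w i * l i)"
    by (simp add: x_def sum_prod)
  moreover have "(\<Sum>i\<in>UNIV. w i * l i) \<le> \<phi> (y - \<eta>) - \<gamma>"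
  proof -
    have "(\<Sum>i\<in>UNIV. \<mu> $ i * (\<gamma> - \<phi> (y - \<eta>) + l i)) \<le> 0"
      using S_le[OF S_mem[OF fin]] \<open>\<beta> \<le> 0\<close> by (simp add: inner_vec_def l_def)
    then have "(\<Sum>i\<in>UNIV. w i * (\<gamma> - \<phi> (y - \<eta>) + l i)) \<le> 0"
      using \<open>M > 0\<close> by (simp add: w_def divide_le_0_iff flip: sum_divide_distrib)
    moreover have "(\<Sum>i\<in>UNIV. w i * (\<gamma> - \<phi> (y - \<eta>) + l i))
        = sum w UNIV * (\<gamma> - \<phi> (y - \<eta>)) + (\<Sum>i\<in>UNIV. w i * l i)"
      by (simp only: distrib_left sum.distrib sum_distrib_right)
    ultimately show ?thesis using w(2) by simp
  qed
  ultimately have "L x \<eta> \<le> ereal (\<phi> (y - \<eta>) - \<gamma>)"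
    by (meson ereal_less_eq(3) order_trans)
  then show False using \<eta> by (cases "L x \<eta>") auto
qed

text \<open>The sets \<open>C x\<close> are compact and convex in \<open>m\<close> dimensions, so by Helly's theorem intersections of
\<open>m + 1\<close> of them decide. The index type \<open>'m option\<close> has exactly this many elements.\<close>

lemma common_sublevel_point:
  assumes below: "\<And>x. x \<in> X \<Longrightarrow> \<exists>\<eta>. - L x \<eta> + ereal (\<phi> (y - \<eta>)) < ereal \<gamma>"
  shows "\<exists>\<eta>. \<forall>x\<in>X. - L x \<eta> \<le> ereal (\<gamma> - \<phi> (y - \<eta>))"
proof -
  define C where "C = (\<lambda>x. {\<eta>. - L x \<eta> \<le> ereal (\<gamma> - \<phi> (y - \<eta>))})"
  have convex_C: "convex (C x)" if x: "x \<in> X" for x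
  proof (rule convexI)
    fix a b :: "real ^ 'm" and u v :: real
    assume ab: "a \<in> C x" "b \<in> C x" and uv: "0 \<le> u" "0 \<le> v" "u + v = 1"
    have "- L x (u *\<^sub>R a + v *\<^sub>R b)
        \<le> ereal (u * \<gamma> + v * \<gamma> - \<phi> (y - (u *\<^sub>R a + v *\<^sub>R b)))"
      using ab by (intro perturbed_convex convex_neg x uv) (simp_all add: C_def)
    moreover have "u * \<gamma> + v * \<gamma> = \<gamma>"
      using uv by (simp flip: distrib_right)
    ultimately show "u *\<^sub>R a + v *\<^sub>R b \<in> C x" by (simp add: C_def)
  qed
  have compact_C: "compact (C x)" if x: "x \<in> X" for x
  proof -
    have "C x = (\<lambda>\<eta>. (\<eta>, \<gamma> - \<phi> (y - \<eta>))) -` {(\<eta>, t). - L x \<eta> \<le> ereal t}"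
      by (auto simp: C_def)
    moreover have "closed ((\<lambda>\<eta>. (\<eta>, \<gamma> - \<phi> (y - \<eta>))) -` {(\<eta>, t). - L x \<eta> \<le> ereal t})"
      by (intro closed_vimage closed_neg[OF x] continuous_intros
          continuous_on_compose2[OF continuous]) auto
    moreover have "bounded (C x)"
    proof -
      obtain a b where ab: "\<And>\<eta>. ereal (a + b \<bullet> \<eta>) \<le> - L x \<eta>" using minorant[OF x] by blast
      obtain R where R: "\<And>\<eta>. a + b \<bullet> \<eta> + \<phi> (y - \<eta>) \<le> \<gamma> \<Longrightarrow> norm \<eta> \<le> R"
        using affine_perturbation_bounded by blast
      have "norm \<eta> \<le> R" if "\<eta> \<in> C x" for \<eta>
      proof (rule R)
        have "ereal (a + b \<bullet> \<eta>) \<le> ereal (\<gamma> - \<phi> (y - \<eta>))"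
          by (rule order_trans[OF ab]) (use that in \<open>simp add: C_def\<close>)
        then show "a + b \<bullet> \<eta> + \<phi> (y - \<eta>) \<le> \<gamma>" by simp
      qed
      then show ?thesis unfolding bounded_iff by blast
    qed
    ultimately show ?thesis by (simp add: compact_eq_bounded_closed)
  qed
  have small: "\<Inter>\<F> \<noteq> {}" if F: "\<F> \<subseteq> C ` X" "finite \<F>" "card \<F> \<le> CARD('m option)" for \<F>
  proof (cases "\<F> = {}")
    case False
    obtain s :: "(real ^ 'm) set \<Rightarrow> 'm option" where "inj_on s \<F>"
      using card_le_inj[OF F(2), of "UNIV :: 'm option set"] F(3) by auto
    then obtain h :: "'m option \<Rightarrow> (real ^ 'm) set" where h: "range h = \<F>"
      using inj_on_iff_surj[OF False, of "UNIV :: 'm option set"] by auto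
    have "\<forall>i. \<exists>x\<in>X. h i = C x" using h F(1) by blast
    then obtain xs where xs: "\<And>i. xs i \<in> X" "\<And>i. h i = C (xs i)" by metis
    obtain \<eta> where "\<And>i. - L (xs i) \<eta> \<le> ereal (\<gamma> - \<phi> (y - \<eta>))"
      using common_sublevel_point_finite[of xs y \<gamma>] xs(1) below by blast
    then have "\<eta> \<in> h i" for i by (simp add: xs(2) C_def)
    then show ?thesis using h by blast
  qed simp
  have "\<Inter>(C ` X) \<noteq> {}"
  proof (rule compact_fip_Heine_Borel)
    fix \<F> assume F: "finite \<F>" "\<F> \<subseteq> C ` X"
    show "\<Inter>\<F> \<noteq> {}"
    proof (cases "card \<F> \<le> CARD('m option)")
      case True
      then show ?thesis using small F by blast
    next
      case False
      show ?thesis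
      proof (rule Helly)
        fix t assume "t \<subseteq> \<F>" "card t = DIM(real ^ 'm) + 1"
        then show "\<Inter>t \<noteq> {}"
          using F by (intro small) (auto intro: finite_subset)
      qed (use False F convex_C in auto)
    qed
  qed (use compact_C in auto)
  then obtain \<eta> where "\<And>x. x \<in> X \<Longrightarrow> \<eta> \<in> C x" by blast
  then show ?thesis unfolding C_def by blast
qed

text \<open>If the left-hand side were larger, a real \<open>\<gamma>\<close> strictly in between would give a common point \<open>\<zeta>\<close> of
all level sets, at which the dual objective beats its optimum at \<open>\<eta>\<close>.\<close>

lemma minimax:
  assumes min: "proximal_min (\<lambda>\<zeta>. - dual_fun L \<zeta>) y \<eta>"
  shows "(INF x. aug_lagrangian L \<phi> x y) \<le> dual_fun L \<eta> - ereal (\<phi> (y - \<eta>))"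
proof (rule ccontr)
  obtain d where d: "dual_fun L \<eta> = ereal d"
    using min by (auto simp: proximal_min_def)
  assume "\<not> ?thesis"
  then have "ereal (d - \<phi> (y - \<eta>)) < (INF x. aug_lagrangian L \<phi> x y)"
    by (simp add: d not_le)
  then obtain \<gamma> where \<gamma>: "d - \<phi> (y - \<eta>) < \<gamma>" "ereal \<gamma> < (INF x. aug_lagrangian L \<phi> x y)"
    using ereal_dense2 by (metis less_ereal.simps(1))
  have "\<exists>\<zeta>. - L x \<zeta> + ereal (\<phi> (y - \<zeta>)) < ereal (- \<gamma>)" if x: "x \<in> X" for x
  proof -
    obtain \<zeta> where \<zeta>: "proximal_min (\<lambda>\<zeta>. - L x \<zeta>) y \<zeta>"
      using aug_maximizer_exists[OF x] by blast
    have "ereal \<gamma> < L x \<zeta> - ereal (\<phi> (y - \<zeta>))"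
      unfolding aug_lagrangian_eq[OF \<zeta>, symmetric] using \<gamma>(2) by (rule less_INF_D) simp
    then show ?thesis by (intro exI[of _ \<zeta>], cases "L x \<zeta>") auto
  qed
  then obtain \<zeta> where "\<forall>x\<in>X. - L x \<zeta> \<le> ereal (- \<gamma> - \<phi> (y - \<zeta>))"
    using common_sublevel_point by blast
  then have "- dual_fun L \<zeta> \<le> ereal (- \<gamma> - \<phi> (y - \<zeta>))"
    by (simp add: neg_dual_le_iff)
  then have "- dual_fun L \<zeta> + ereal (\<phi> (y - \<zeta>)) \<le> ereal (- \<gamma>)"
    by (cases "dual_fun L \<zeta>") auto
  moreover have "- dual_fun L \<eta> + ereal (\<phi> (y - \<eta>)) \<le> - dual_fun L \<zeta> + ereal (\<phi> (y - \<zeta>))"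
    using min by (auto simp: proximal_min_def)
  ultimately have "- dual_fun L \<eta> + ereal (\<phi> (y - \<eta>)) \<le> ereal (- \<gamma>)"
    by (rule order_trans[rotated])
  then show False using \<gamma>(1) by (simp add: d)
qed

text \<open>The affine minorant of \<open>- L x\<close> given by the optimality condition also minorizes \<open>- dual_fun L\<close>,
and at \<open>\<eta>\<close> the two functions differ by at most \<open>e\<close>.\<close>

lemma eps_subgradient:
  assumes x: "x \<in> X" and min: "proximal_min (\<lambda>\<zeta>. - L x \<zeta>) y \<eta>"
    and le: "L x \<eta> \<le> (INF x. L x \<eta>) + ereal e"
  shows "d\<phi> (y - \<eta>) \<in> eps_subdifferential e (\<lambda>\<zeta>. - dual_fun L \<zeta>) \<eta>"
proof -
  obtain l where l: "L x \<eta> = ereal l"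
    using min by (auto simp: proximal_min_def)
  have le': "ereal l \<le> dual_fun L \<eta> + ereal e"
    using le by (simp add: l dual_fun_def)
  obtain d where d: "dual_fun L \<eta> = ereal d"
    using le' dual_fun_le[of \<eta> x] by (cases "dual_fun L \<eta>") (auto simp: l)
  have "- dual_fun L \<eta> + ereal (d\<phi> (y - \<eta>) \<bullet> (\<zeta> - \<eta>)) - ereal e \<le> - dual_fun L \<zeta>" for \<zeta>
  proof -
    have "- dual_fun L \<eta> + ereal (d\<phi> (y - \<eta>) \<bullet> (\<zeta> - \<eta>)) - ereal e
        \<le> - L x \<eta> + ereal (d\<phi> (y - \<eta>) \<bullet> (\<zeta> - \<eta>))"
      using le' by (simp add: d l)
    also have "\<dots> \<le> - L x \<zeta>"
      by (rule proximal_min_optimality[OF convex_neg[OF x] min])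
    also have "\<dots> \<le> - dual_fun L \<zeta>"
      by (simp add: dual_fun_le)
    finally show ?thesis .
  qed
  then show ?thesis
    by (simp add: eps_subdifferential_def edom_def d)
qed

text \<open>The growth of the objective for \<open>x\<close> from its minimizer \<open>\<eta>\<close> to the proximal point \<open>\<pi>\<close> is bounded by
the gap between the value at \<open>x\<close> and the dual value at \<open>\<pi>\<close>, which \<open>minimax\<close> bounds by \<open>e\<close>.\<close>

lemma inexact_proximal_point:
  assumes x: "x \<in> X" and min: "proximal_min (\<lambda>\<zeta>. - L x \<zeta>) y \<eta>"
    and le: "aug_lagrangian L \<phi> x y \<le> (INF x. aug_lagrangian L \<phi> x y) + ereal e"
  shows "c * \<phi> (\<eta> - prox_map (\<lambda>\<zeta>. - dual_fun L \<zeta>) \<phi> y) \<le> e"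
proof -
  obtain \<pi> where \<pi>: "proximal_min (\<lambda>\<zeta>. - dual_fun L \<zeta>) y \<pi>"
    using dual_prox_exists by blast
  have prox: "prox_map (\<lambda>\<zeta>. - dual_fun L \<zeta>) \<phi> y = \<pi>"
    by (rule prox_map_eq[OF neg_dual_convex \<pi>])
  obtain l where l: "L x \<eta> = ereal l"
    using min by (auto simp: proximal_min_def)
  obtain d where d: "dual_fun L \<pi> = ereal d"
    using \<pi> by (auto simp: proximal_min_def)
  have "- L x \<eta> + ereal (\<phi> (y - \<eta>)) + ereal (c * \<phi> (\<pi> - \<eta>)) \<le> - L x \<pi> + ereal (\<phi> (y - \<pi>))"
    by (rule proximal_min_growth[OF convex_neg[OF x] min])
  also have "\<dots> \<le> - dual_fun L \<pi> + ereal (\<phi> (y - \<pi>))"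
    by (intro add_right_mono) (simp add: dual_fun_le)
  finally have "- l + \<phi> (y - \<eta>) + c * \<phi> (\<pi> - \<eta>) \<le> - d + \<phi> (y - \<pi>)"
    by (simp add: l d)
  moreover have "l - \<phi> (y - \<eta>) \<le> d - \<phi> (y - \<pi>) + e"
  proof -
    have "ereal (l - \<phi> (y - \<eta>)) = aug_lagrangian L \<phi> x y"
      by (simp add: aug_lagrangian_eq[OF min] l)
    also note le
    also have "(INF x. aug_lagrangian L \<phi> x y) + ereal e \<le> dual_fun L \<pi> - ereal (\<phi> (y - \<pi>)) + ereal e"
      by (intro add_right_mono minimax[OF \<pi>])
    finally show ?thesis by (simp add: d)
  qed
  ultimately show ?thesis
    using even[of "\<eta> - \<pi>"] by (simp add: prox)
qed

text \<open>Move from \<open>x0\<close> a fraction \<open>t\<close> towards \<open>x\<close> and let \<open>\<eta>\<close> be the maximizer at the new point. Convexity of \<open>L\<close>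
in its first argument compares its value with those at \<open>x0\<close> and \<open>x\<close>. As the value at \<open>x0\<close> drops by at least
\<open>c * \<phi> (\<eta> - \<eta>0)\<close> away from \<open>\<eta>0\<close>, dividing by \<open>t\<close> yields the desired inequality at \<open>\<eta>\<close>
instead of \<open>\<eta>0\<close>, kernel terms included, together with \<open>\<eta> \<longlongrightarrow> \<eta>0\<close> as \<open>t\<close> tends to \<open>0\<close>. Closedness of
\<open>- L x\<close> passes to the limit.\<close>

lemma subgradient_transfer:
  assumes x0: "x0 \<in> X" and min: "proximal_min (\<lambda>\<zeta>. - L x0 \<zeta>) y \<eta>0"
    and sub: "\<And>x. aug_lagrangian L \<phi> x0 y + ereal (e \<bullet> (x - x0)) \<le> aug_lagrangian L \<phi> x y"
  shows "L x0 \<eta>0 + ereal (e \<bullet> (x - x0)) \<le> L x \<eta>0"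
proof (cases "x \<in> X")
  case False
  then show ?thesis using dom_x[of x \<eta>0] by auto
next
  case x: True
  define d where "d = x - x0"
  obtain l0 where l0: "L x0 \<eta>0 = ereal l0"
    using min by (auto simp: proximal_min_def)
  define A where "A = l0 - \<phi> (y - \<eta>0)"
  have aug0: "aug_lagrangian L \<phi> x0 y = ereal A"
    by (simp add: aug_lagrangian_eq[OF min] l0 A_def)
  obtain V where V: "aug_lagrangian L \<phi> x y = ereal V"
    using aug_lagrangian_finite[OF x] by auto
  have step: "\<exists>\<eta>. - L x \<eta> \<le> ereal (- A - e \<bullet> d - \<phi> (y - \<eta>)) \<and>
      (1 - t) * (c * \<phi> (\<eta> - \<eta>0)) \<le> t * (V - A - e \<bullet> d)" if t: "0 < t" "t < 1" for t
  proof -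
    define z where "z = (1 - t) *\<^sub>R x0 + t *\<^sub>R x"
    have z: "z \<in> X"
      unfolding z_def by (rule convexD[OF convex_X x0 x]) (use t in auto)
    have zd: "z - x0 = t *\<^sub>R d" by (simp add: z_def d_def algebra_simps)
    obtain \<eta> where \<eta>: "proximal_min (\<lambda>\<zeta>. - L z \<zeta>) y \<eta>"
      using aug_maximizer_exists[OF z] by blast
    then obtain m where m: "L z \<eta> = ereal m" by (auto simp: proximal_min_def)
    obtain a where a: "L x0 \<eta> = ereal a"
      using common_domain[OF z x0, of \<eta>] dom_x[of x0 \<eta>] x0 m by (cases "L x0 \<eta>") auto
    obtain b where b: "L x \<eta> = ereal b"
      using common_domain[OF z x, of \<eta>] dom_x[of x \<eta>] x m by (cases "L x \<eta>") auto
    have "ereal m \<le> ereal ((1 - t) * a + t * b)"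
      unfolding m[symmetric] z_def
      by (rule convex_funD[OF convex_x]) (use t a b in auto)
    moreover have "ereal (A + t * (e \<bullet> d)) \<le> ereal (m - \<phi> (y - \<eta>))"
      using sub[of z] by (simp add: aug0 zd aug_lagrangian_eq[OF \<eta>] m)
    ultimately have *: "A + t * (e \<bullet> d) \<le> (1 - t) * a + t * b - \<phi> (y - \<eta>)" by simp
    have "- L x0 \<eta>0 + ereal (\<phi> (y - \<eta>0)) + ereal (c * \<phi> (\<eta> - \<eta>0)) \<le> - L x0 \<eta> + ereal (\<phi> (y - \<eta>))"
      by (rule proximal_min_growth[OF convex_neg[OF x0] min])
    then have "a - \<phi> (y - \<eta>) + c * \<phi> (\<eta> - \<eta>0) \<le> A"
      by (simp add: l0 a A_def)
    then have "(1 - t) * (a - \<phi> (y - \<eta>) + c * \<phi> (\<eta> - \<eta>0)) \<le> (1 - t) * A"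
      using t by (intro mult_left_mono) auto
    with * have **: "(1 - t) * (c * \<phi> (\<eta> - \<eta>0)) \<le> t * (b - \<phi> (y - \<eta>) - A - e \<bullet> d)"
      by (simp add: algebra_simps)
    have "0 \<le> (1 - t) * (c * \<phi> (\<eta> - \<eta>0))"
      using t c nonneg by simp
    then have "0 \<le> b - \<phi> (y - \<eta>) - A - e \<bullet> d"
      using ** t by (smt (verit) zero_le_mult_iff)
    moreover have "b - \<phi> (y - \<eta>) \<le> V"
      using aug_lagrangian_ge[of x \<eta> y] by (simp add: b V)
    then have "t * (b - \<phi> (y - \<eta>) - A - e \<bullet> d) \<le> t * (V - A - e \<bullet> d)"
      using t by (intro mult_left_mono) auto
    ultimately show ?thesis
      using ** b by (intro exI[of _ \<eta>]) auto
  qed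
  \<comment> \<open>The shift by \<open>2\<close> keeps \<open>t n\<close> below \<open>1\<close> at \<open>n = 0\<close>.\<close>
  define t :: "nat \<Rightarrow> real" where "t = (\<lambda>n. 1 / (real n + 2))"
  have "\<forall>n. \<exists>\<eta>. - L x \<eta> \<le> ereal (- A - e \<bullet> d - \<phi> (y - \<eta>)) \<and>
      (1 - t n) * (c * \<phi> (\<eta> - \<eta>0)) \<le> t n * (V - A - e \<bullet> d)"
    by (intro allI step) (auto simp: t_def)
  then obtain \<eta> where \<eta>: "\<And>n. - L x (\<eta> n) \<le> ereal (- A - e \<bullet> d - \<phi> (y - \<eta> n))"
    and small: "\<And>n. (1 - t n) * (c * \<phi> (\<eta> n - \<eta>0)) \<le> t n * (V - A - e \<bullet> d)"
    by metis
  have t0: "t \<longlonglongrightarrow> 0"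
    unfolding t_def using LIMSEQ_ignore_initial_segment[OF lim_1_over_n[where 'a = real], of 2]
    by (simp add: add.commute)
  have "(\<lambda>n. \<phi> (\<eta> n - \<eta>0)) \<longlonglongrightarrow> 0"
  proof (rule tendsto_sandwich[where f = "\<lambda>_. 0"])
    have "\<phi> (\<eta> n - \<eta>0) \<le> t n * (V - A - e \<bullet> d) / ((1 - t n) * c)" for n
    proof -
      have "0 < 1 - t n" by (simp add: t_def)
      then show ?thesis using small[of n] c by (simp add: pos_le_divide_eq mult_ac)
    qed
    then show "\<forall>\<^sub>F n in sequentially. \<phi> (\<eta> n - \<eta>0) \<le> t n * (V - A - e \<bullet> d) / ((1 - t n) * c)"
      by simp
    have "(\<lambda>n. t n * (V - A - e \<bullet> d) / ((1 - t n) * c)) \<longlonglongrightarrow> 0 * (V - A - e \<bullet> d) / ((1 - 0) * c)"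
      by (intro tendsto_intros t0) (use c in auto)
    then show "(\<lambda>n. t n * (V - A - e \<bullet> d) / ((1 - t n) * c)) \<longlonglongrightarrow> 0" by simp
  qed (use nonneg in auto)
  then have "(\<lambda>n. \<eta> n - \<eta>0) \<longlonglongrightarrow> 0"
    by (rule tendsto_zero_if_value_tendsto_zero)
  then have lim: "\<eta> \<longlonglongrightarrow> \<eta>0" by (simp add: LIM_zero_cancel)
  have "isCont \<phi> (y - \<eta>0)"
    using continuous[of UNIV] by (simp add: continuous_on_eq_continuous_at)
  then have "(\<lambda>n. \<phi> (y - \<eta> n)) \<longlonglongrightarrow> \<phi> (y - \<eta>0)"
    by (rule isCont_tendsto_compose) (intro tendsto_intros lim)
  then have "(\<lambda>n. (\<eta> n, - A - e \<bullet> d - \<phi> (y - \<eta> n))) \<longlonglongrightarrow> (\<eta>0, - A - e \<bullet> d - \<phi> (y - \<eta>0))"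
    by (intro tendsto_intros lim)
  then have "(\<eta>0, - A - e \<bullet> d - \<phi> (y - \<eta>0)) \<in> {(\<eta>, t). - L x \<eta> \<le> ereal t}"
    by (rule closed_sequentially[OF closed_neg[OF x], rotated]) (use \<eta> in simp)
  then have "- L x \<eta>0 \<le> ereal (- l0 - e \<bullet> d)"
    by (simp add: A_def)
  then show ?thesis
    by (cases "L x \<eta>0") (auto simp: l0 d_def)
qed

text \<open>Over \<open>X\<close> the linear function \<open>e\<close> drops by at most \<open>norm e * diameter X \<le> \<epsilon>\<close> from its value at \<open>x0\<close>.
If the diameter is \<open>0\<close>, the bound on \<open>norm e\<close> reads \<open>\<infinity>\<close>, but then \<open>X = {x0}\<close>.\<close>

lemma subgradient_criterion:
  assumes x0: "x0 \<in> X" and min: "proximal_min (\<lambda>\<zeta>. - L x0 \<zeta>) y \<eta>0"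
    and bounded: "bounded X"
    and sub: "e \<in> subdifferential (\<lambda>x. aug_lagrangian L \<phi> x y) x0"
    and small: "ereal (norm e) \<le> ereal \<epsilon> / ereal (diameter X)" and \<epsilon>: "0 \<le> \<epsilon>"
  shows "L x0 \<eta>0 \<le> (INF x. L x \<eta>0) + ereal \<epsilon>"
    and "aug_lagrangian L \<phi> x0 y \<le> (INF x. aug_lagrangian L \<phi> x y) + ereal \<epsilon>"
proof -
  have sub': "aug_lagrangian L \<phi> x0 y + ereal (e \<bullet> (x - x0)) \<le> aug_lagrangian L \<phi> x y" for x
    using sub by (simp add: subdifferential_def)
  have slope: "- \<epsilon> \<le> e \<bullet> (x - x0)" if x: "x \<in> X" for x
  proof (cases "x = x0")
    case False
    have d: "norm (x - x0) \<le> diameter X"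
      using diameter_bounded_bound[OF bounded x x0] by (simp add: dist_norm)
    moreover have "0 < norm (x - x0)" using False by simp
    ultimately have D: "0 < diameter X" by linarith
    then have "norm e \<le> \<epsilon> / diameter X" using small by simp
    then have "norm e * norm (x - x0) \<le> \<epsilon> / diameter X * diameter X"
      using d \<epsilon> D by (intro mult_mono) auto
    then have "norm e * norm (x - x0) \<le> \<epsilon>" using D by simp
    then show ?thesis
      using norm_cauchy_schwarz[of "- e" "x - x0"] by simp
  qed (use \<epsilon> in simp)
  have conclude: "h x0 \<le> (INF x. h x) + ereal \<epsilon>"
    if sub: "\<And>x. h x0 + ereal (e \<bullet> (x - x0)) \<le> h x" and out: "\<And>x. x \<notin> X \<Longrightarrow> h x = \<infinity>" for h :: "'a \<Rightarrow> ereal"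
    unfolding le_INF_add_ereal
  proof
    fix x
    show "h x0 \<le> h x + ereal \<epsilon>"
    proof (cases "x \<in> X")
      case True
      then show ?thesis
        using sub[of x] slope[of x] by (cases "h x0"; cases "h x") auto
    qed (simp add: out)
  qed
  show "aug_lagrangian L \<phi> x0 y \<le> (INF x. aug_lagrangian L \<phi> x y) + ereal \<epsilon>"
    by (rule conclude) (simp_all add: sub' aug_lagrangian_outside)
  have "L x \<eta>0 = \<infinity>" if "x \<notin> X" for x
    using that dom_x[of x \<eta>0] by auto
  then show "L x0 \<eta>0 \<le> (INF x. L x \<eta>0) + ereal \<epsilon>"
    by (intro conclude subgradient_transfer[OF x0 min sub'])
qed

end

section \<open>The Lagrangian of the composite problem\<close>

lemma ereal_real_edom:
  assumes "proper_fun h" "u \<in> edom h"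
  shows "h u = ereal (real_of_ereal (h u))"
  using assms unfolding proper_fun_def edom_def by (cases "h u") auto

lemma conjugate_le_iff:
  assumes "proper_fun g"
  shows "convex_conjugate g \<eta> \<le> ereal s \<longleftrightarrow> (\<forall>u\<in>edom g. u \<bullet> \<eta> - real_of_ereal (g u) \<le> s)"
proof -
  have "ereal (u \<bullet> \<eta>) - g u \<le> ereal s \<longleftrightarrow> u \<in> edom g \<longrightarrow> u \<bullet> \<eta> - real_of_ereal (g u) \<le> s" for u
    using assms unfolding proper_fun_def edom_def by (cases "g u") auto
  then show ?thesis
    unfolding convex_conjugate_def by (auto simp: SUP_le_iff)
qed

lemma conjugate_not_MInf:
  assumes "proper_fun g"
  shows "convex_conjugate g \<eta> \<noteq> - \<infinity>"
proof
  assume *: "convex_conjugate g \<eta> = - \<infinity>"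
  obtain u where "u \<in> edom g" using assms by (auto simp: proper_fun_def)
  then show False
    using conjugate_le_iff[OF assms, of \<eta> "u \<bullet> \<eta> - real_of_ereal (g u) - 1"] * by auto
qed

text \<open>\<open>- L x\<close> is a supremum of affine functions, one for each point of the domain of \<open>g\<close>. The epigraph is
therefore an intersection of half-spaces.\<close>

lemma neg_lagrangian_le_iff:
  assumes f: "proper_fun f" and g: "proper_fun g" and x: "x \<in> edom f"
  shows "- lagrangian f g A x \<eta> \<le> ereal t \<longleftrightarrow>
    (\<forall>u\<in>edom g. (u - A x) \<bullet> \<eta> - real_of_ereal (g u) - real_of_ereal (f x) \<le> t)"
proof -
  obtain a where a: "f x = ereal a"
    using ereal_real_edom[OF f x] by blast
  have "- lagrangian f g A x \<eta> \<le> ereal t \<longleftrightarrow> convex_conjugate g \<eta> \<le> ereal (t + A x \<bullet> \<eta> + a)"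
    using x a by (cases "convex_conjugate g \<eta>") (auto simp: lagrangian_def edom_def)
  then show ?thesis
    by (auto simp: conjugate_le_iff[OF g] a inner_diff_left algebra_simps)
qed

lemma epigraph_neg_lagrangian:
  assumes f: "proper_fun f" and g: "proper_fun g" and x: "x \<in> edom f"
  shows "{(\<eta>, t::real). - lagrangian f g A x \<eta> \<le> ereal t} =
    (\<Inter>u\<in>edom g. {z. (u - A x, - 1) \<bullet> z \<le> real_of_ereal (g u) + real_of_ereal (f x)})"
  by (auto simp: neg_lagrangian_le_iff[OF assms] algebra_simps)

lemma augmented_saddle_lagrangian:
  fixes f :: "real ^ 'n \<Rightarrow> ereal" and g :: "real ^ 'm \<Rightarrow> ereal"
  assumes kernel: "prox_kernel \<phi> d\<phi> p c"
    and f: "proper_fun f" and g: "proper_fun g"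
    and L_convex: "\<And>\<eta>. convex_fun (\<lambda>x. lagrangian f g A x \<eta>)"
    and dual: "\<exists>\<eta>. dual_fun (lagrangian f g A) \<eta> \<noteq> - \<infinity>"
  shows "augmented_saddle \<phi> d\<phi> p c (lagrangian f g A) (edom f)"
proof -
  interpret prox_kernel \<phi> d\<phi> p c by (fact kernel)
  show ?thesis
  proof
    fix x \<eta>
    show "convex_fun (\<lambda>x. lagrangian f g A x \<eta>)" by (fact L_convex)
    show "lagrangian f g A x \<eta> < \<infinity> \<longleftrightarrow> x \<in> edom f"
      using ereal_real_edom[OF f, of x] conjugate_not_MInf[OF g, of \<eta>]
      by (cases "f x"; cases "convex_conjugate g \<eta>") (auto simp: lagrangian_def edom_def)
    show "lagrangian f g A x' \<eta> \<noteq> - \<infinity>"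
      if "x \<in> edom f" "x' \<in> edom f" "lagrangian f g A x \<eta> \<noteq> - \<infinity>" for x'
    proof -
      have "convex_conjugate g \<eta> \<noteq> \<infinity>"
        using that by (auto simp: lagrangian_def edom_def)
      then show ?thesis
        using ereal_real_edom[OF f that(2)] conjugate_not_MInf[OF g, of \<eta>]
        by (cases "f x'"; cases "convex_conjugate g \<eta>") (auto simp: lagrangian_def edom_def)
    qed
    assume x: "x \<in> edom f"
    show "convex_fun (\<lambda>\<eta>. - lagrangian f g A x \<eta>)"
      unfolding convex_fun_def epigraph_neg_lagrangian[OF f g x]
      by (intro convex_INT convex_halfspace_le)
    show "closed {(\<eta>, t::real). - lagrangian f g A x \<eta> \<le> ereal t}"
      unfolding epigraph_neg_lagrangian[OF f g x]
      by (intro closed_INT ballI closed_halfspace_le)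
    obtain u where u: "u \<in> edom g" using g by (auto simp: proper_fun_def)
    have "ereal (- real_of_ereal (g u) - real_of_ereal (f x) + (u - A x) \<bullet> \<eta>)
        \<le> - lagrangian f g A x \<eta>" for \<eta>
      by (rule ereal_le_real) (use u in \<open>auto simp: neg_lagrangian_le_iff[OF f g x] algebra_simps\<close>)
    then show "\<exists>a b. \<forall>\<eta>. ereal (a + b \<bullet> \<eta>) \<le> - lagrangian f g A x \<eta>" by blast
  next
    show "edom f \<noteq> {}" using f by (simp add: proper_fun_def)
    show "\<exists>\<eta>. dual_fun (lagrangian f g A) \<eta> \<noteq> - \<infinity>" by (fact dual)
  qed
qed

theorem proposition4p1:
  fixes f :: "real ^ 'n \<Rightarrow> ereal"
    and g :: "real ^ 'm \<Rightarrow> ereal"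
    and A :: "real ^ 'n \<Rightarrow> real ^ 'm"
    and r p lam \<epsilon> :: real
    and y y_plus :: "real ^ 'm"
    and x_plus :: "real ^ 'n"
    and \<phi> :: "real ^ 'm \<Rightarrow> real"
    and \<psi> :: "real ^ 'm \<Rightarrow> ereal"
    and L L_aug :: "real ^ 'n \<Rightarrow> real ^ 'm \<Rightarrow> ereal"
  defines "\<phi> \<equiv> prox_fun r p"
    and "L \<equiv> lagrangian f g A"
    and "L_aug \<equiv> aug_lagrangian L (epi_scale lam \<phi>)"
    and "\<psi> \<equiv> (\<lambda>\<eta>. - dual_fun L \<eta>)"
    and "y_plus \<equiv> y + lam *\<^sub>R gradient (prox_fun_conj r p) (grad_y L_aug x_plus y)"
  assumes f: "proper_fun f" "lsc_fun f" "convex_fun f"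
    and g: "proper_fun g" "lsc_fun g" "convex_fun g"
    and primal_convex: "convex_fun (primal_fun f g A)"
    and L_convex: "\<And>\<eta>. convex_fun (\<lambda>x. L x \<eta>)"
    and strong_duality: "(SUP \<eta>. dual_fun L \<eta>) = (INF x. primal_fun f g A x)"
    and primal_solution: "\<exists>x. primal_fun f g A x = (INF x'. primal_fun f g A x')"
    and dual_solution: "\<exists>\<eta>. dual_fun L \<eta> = (SUP \<eta>'. dual_fun L \<eta>')"
    and p: "p \<ge> 1"
    and r: "r = 2 \<or> r = p + 1"
    and "lam > 0"
    and "\<epsilon> > 0"
    and "x_plus \<in> edom f"
  shows
    "(L x_plus y_plus \<le> (INF x. L x y_plus) + ereal \<epsilon>
        \<longrightarrow> - grad_y L_aug x_plus y \<in> eps_subdifferential \<epsilon> \<psi> y_plus)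
   \<and> (L_aug x_plus y \<le> (INF x. L_aug x y) + ereal \<epsilon>
        \<longrightarrow> epi_scale lam \<phi> (y_plus - prox_map \<psi> (epi_scale lam \<phi>) y) \<le> 2 powr (p - 1) * \<epsilon>)
   \<and> (bounded (edom f)
        \<longrightarrow> (\<forall>e. e \<in> subdifferential (\<lambda>x. L_aug x y) x_plus
               \<and> ereal (norm e) \<le> ereal \<epsilon> / ereal (diameter (edom f))
             \<longrightarrow> L x_plus y_plus \<le> (INF x. L x y_plus) + ereal \<epsilon>
               \<and> L_aug x_plus y \<le> (INF x. L_aug x y) + ereal \<epsilon>))"
proof -
  obtain d\<phi> where kernel0: "prox_kernel \<phi> d\<phi> p (2 powr (1 - p))"
    using prox_kernel_prox_fun[OF p r] unfolding \<phi>_def by blast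
  \<comment> \<open>The saddle-point theory is applied to the epi-scaled kernel, the conjugacy of gradients to
    the unscaled one.\<close>
  define k where "k = epi_scale lam \<phi>"
  define dk where "dk = (\<lambda>z. d\<phi> (inverse lam *\<^sub>R z))"
  have kernel: "prox_kernel k dk p (2 powr (1 - p))"
    unfolding k_def dk_def by (rule prox_kernel.epi_scale_kernel[OF kernel0 \<open>lam > 0\<close>])
  \<comment> \<open>The common optimal value is attained by the primal, hence is not \<open>- \<infinity>\<close>, and is attained by the dual.\<close>
  have "\<exists>\<eta>. dual_fun L \<eta> \<noteq> - \<infinity>"
  proof -
    have "primal_fun f g A x \<noteq> - \<infinity>" for x
      using f(1) g(1) unfolding proper_fun_def primal_fun_def by simp
    then show ?thesis
      using dual_solution primal_solution strong_duality by metis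
  qed
  then interpret augmented_saddle k dk p "2 powr (1 - p)" L "edom f"
    unfolding L_def by (intro augmented_saddle_lagrangian kernel f(1) g(1) L_convex[unfolded L_def])
  have L_aug: "L_aug = aug_lagrangian L k"
    by (simp add: L_aug_def k_def)
  obtain \<eta> where \<eta>: "proximal_min (\<lambda>\<zeta>. - L x_plus \<zeta>) y \<eta>"
    using aug_maximizer_exists[OF \<open>x_plus \<in> edom f\<close>] by blast
  have grad: "grad_y L_aug x_plus y = - dk (y - \<eta>)"
    unfolding L_aug by (rule grad_y_aug_lagrangian[OF \<open>x_plus \<in> edom f\<close> \<eta>])
  have "grad_y L_aug x_plus y = d\<phi> (inverse lam *\<^sub>R (\<eta> - y))"
    using prox_kernel.odd[OF kernel0, of "inverse lam *\<^sub>R (y - \<eta>)"]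
    unfolding grad dk_def by (simp add: scaleR_diff_right)
  then have "gradient (prox_fun_conj r p) (grad_y L_aug x_plus y) = inverse lam *\<^sub>R (\<eta> - y)"
    using prox_kernel.gradient_conjugate[OF kernel0, of "inverse lam *\<^sub>R (\<eta> - y)"]
    unfolding \<phi>_def prox_fun_conj_def[abs_def] by simp
  then have y_plus: "y_plus = \<eta>"
    unfolding y_plus_def using \<open>lam > 0\<close> by simp
  have rescale: "k z \<le> 2 powr (p - 1) * \<epsilon>" if "2 powr (1 - p) * k z \<le> \<epsilon>" for z
  proof -
    have "2 powr (p - 1) * (2 powr (1 - p) * k z) \<le> 2 powr (p - 1) * \<epsilon>"
      using that by (intro mult_left_mono) auto
    moreover have "2 powr (p - 1) * 2 powr (1 - p) = (1::real)"
      by (simp flip: powr_add)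
    ultimately show ?thesis by (simp flip: mult.assoc)
  qed
  show ?thesis
    unfolding y_plus k_def[symmetric]
  proof (intro conjI impI allI)
    assume "L x_plus \<eta> \<le> (INF x. L x \<eta>) + ereal \<epsilon>"
    then show "- grad_y L_aug x_plus y \<in> eps_subdifferential \<epsilon> \<psi> \<eta>"
      unfolding grad \<psi>_def minus_minus
      by (rule eps_subgradient[OF \<open>x_plus \<in> edom f\<close> \<eta>])
  next
    assume "L_aug x_plus y \<le> (INF x. L_aug x y) + ereal \<epsilon>"
    then show "k (\<eta> - prox_map \<psi> k y) \<le> 2 powr (p - 1) * \<epsilon>"
      unfolding L_aug \<psi>_def
      by (intro rescale inexact_proximal_point[OF \<open>x_plus \<in> edom f\<close> \<eta>])
  next
    fix e
    assume bdd: "bounded (edom f)"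
      and "e \<in> subdifferential (\<lambda>x. L_aug x y) x_plus \<and> ereal (norm e) \<le> ereal \<epsilon> / ereal (diameter (edom f))"
    then have e: "e \<in> subdifferential (\<lambda>x. aug_lagrangian L k x y) x_plus"
      "ereal (norm e) \<le> ereal \<epsilon> / ereal (diameter (edom f))"
      by (simp_all add: L_aug)
    note * = subgradient_criterion[OF \<open>x_plus \<in> edom f\<close> \<eta> bdd e less_imp_le[OF \<open>\<epsilon> > 0\<close>]]
    show "L x_plus \<eta> \<le> (INF x. L x \<eta>) + ereal \<epsilon>" by (fact *(1))
    show "L_aug x_plus y \<le> (INF x. L_aug x y) + ereal \<epsilon>" unfolding L_aug by (fact *(2))
  qed
qed

end
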